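(* Let $D$ be an integral domain and let $\Theta$ be a Jaffard family of $D$. Then there is an exact sequence $$0\longrightarrow\mathrm{Pic}(D,\Theta)\longrightarrow\mathrm{Pic}(\mathrm{Int}(D))\longrightarrow\bigoplus_{T\in\Theta}\mathrm{Pic}(\mathrm{Int}(T))\longrightarrow 0,$$ where the first map is $[I]\mapsto[I\,\mathrm{Int}(D)]$ and the second is $[J]\mapsto([J\,\mathrm{Int}(T)])_{T\in\Theta}$.
   Context: $D$ is an integral domain with quotient field $K$; $\mathrm{Int}(A)=\{f\in K[X]\mid f(A)\subseteq A\}$ for an overring $A$ of $D$. For an integral domain $A$, $\mathrm{Pic}(A)$ is the group of invertible fractional ideals of $A$ modulo principal fractional ideals. An overring is a ring between $D$ and $K$; it is flat if it is flat as a $D$-module. For a family $\Theta$ of flat overrings, $\mathrm{Pic}(D,\Theta)=\{[I]\in\mathrm{Pic}(D)\mid IT \text{ is principal for all } T\in\Theta\}$. A family $\Theta$ of overrings of $D$ is a pre-Jaffard family if: either $\Theta=\{K\}$ or $K\notin\Theta$; every $T\in\Theta$ is flat over $D$; $\Theta$ is complete (every ideal $I$ of $D$ satisfies $I=\bigcap_{T\in\Theta}IT$); $\Theta$ is independent ($TT'=K$ for $T\neq T'$ in $\Theta$); and $\Theta$ is compact in the Zariski topology of the set of overrings of $D$ (the topology with subbasic open sets $\{T\mid x_1,\dots,x_n\in T\}$, $x_i\in K$). A Jaffard family is a pre-Jaffard family that is locally finite: every nonzero $x\in D$ is a nonunit in only finitely many $T\in\Theta$. *)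

theory Defs
  imports "HOL-Analysis.Analysis" "HOL-Algebra.Algebra"
    "HOL-Computational_Algebra.Polynomial" "HOL-Computational_Algebra.Fraction_Field"
begin

definition is_subring :: "'f::field set \<Rightarrow> bool" where
  "is_subring R \<longleftrightarrow> 0 \<in> R \<and> 1 \<in> R \<and>
     (\<forall>x\<in>R. \<forall>y\<in>R. x + y \<in> R \<and> - x \<in> R \<and> x * y \<in> R)"

definition domain_with_qf :: "'k::field set \<Rightarrow> bool" where
  "domain_with_qf D \<longleftrightarrow> is_subring D \<and> (\<forall>x. \<exists>a\<in>D. \<exists>b\<in>D. b \<noteq> 0 \<and> x = a / b)"

definition rgen :: "'f::field set \<Rightarrow> 'f set \<Rightarrow> 'f set" where
  "rgen R S = {\<Sum>i<n. r i * s i | (n::nat) r s. \<forall>i<n. r i \<in> R \<and> s i \<in> S}"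

definition ideal_prod :: "'f::field set \<Rightarrow> 'f set \<Rightarrow> 'f set \<Rightarrow> 'f set" where
  "ideal_prod R I J = rgen R {a * b | a b. a \<in> I \<and> b \<in> J}"

text \<open>(Nonzero) fractional ideal of R (R a subring of 'f whose quotient field is 'f).\<close>
definition frac_ideal :: "'f::field set \<Rightarrow> 'f set \<Rightarrow> bool" where
  "frac_ideal R I \<longleftrightarrow> rgen R I = I \<and> I \<noteq> {0} \<and> (\<exists>d\<in>R. d \<noteq> 0 \<and> (\<forall>x\<in>I. d * x \<in> R))"

definition invertible_ideal :: "'f::field set \<Rightarrow> 'f set \<Rightarrow> bool" where
  "invertible_ideal R I \<longleftrightarrow> frac_ideal R I \<and> (\<exists>J. frac_ideal R J \<and> ideal_prod R I J = R)"

definition principal_ideal :: "'f::field set \<Rightarrow> 'f set \<Rightarrow> bool" where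
  "principal_ideal R I \<longleftrightarrow> (\<exists>x. x \<noteq> 0 \<and> I = (\<lambda>r. x * r) ` R)"

definition InvIdeals :: "'f::field set \<Rightarrow> 'f set monoid" where
  "InvIdeals R = \<lparr>carrier = {I. invertible_ideal R I}, mult = ideal_prod R, one = R\<rparr>"

definition Pic :: "'f::field set \<Rightarrow> 'f set set monoid" where
  "Pic R = InvIdeals R Mod {I. principal_ideal R I}"

text \<open>Map on Picard groups induced by a map F on ideals: the class of I goes to the class of F I.
  (The union is a single class exactly when F is compatible with the classes.)\<close>
definition induced :: "'g::field set \<Rightarrow> ('f set \<Rightarrow> 'g set) \<Rightarrow> 'f set set \<Rightarrow> 'g set set" where
  "induced R' F C = (\<Union>I\<in>C. {J. principal_ideal R' J} #>\<^bsub>InvIdeals R'\<^esub> F I)"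

definition overring :: "'k::field set \<Rightarrow> 'k set \<Rightarrow> bool" where
  "overring D T \<longleftrightarrow> is_subring T \<and> D \<subseteq> T"

text \<open>Flatness of T as a D-module, via the equational criterion of flatness.\<close>
definition flat_over :: "'k::field set \<Rightarrow> 'k set \<Rightarrow> bool" where
  "flat_over D T \<longleftrightarrow> (\<forall>n (r::nat \<Rightarrow> 'k) (m::nat \<Rightarrow> 'k).
      (\<forall>i<n. r i \<in> D \<and> m i \<in> T) \<and> (\<Sum>i<n. r i * m i) = 0 \<longrightarrow>
      (\<exists>k (a::nat \<Rightarrow> nat \<Rightarrow> 'k) (m'::nat \<Rightarrow> 'k).
         (\<forall>i<n. \<forall>j<k. a i j \<in> D) \<and> (\<forall>j<k. m' j \<in> T) \<and>
         (\<forall>i<n. m i = (\<Sum>j<k. a i j * m' j)) \<and>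
         (\<forall>j<k. (\<Sum>i<n. r i * a i j) = 0)))"

definition is_ideal :: "'k::field set \<Rightarrow> 'k set \<Rightarrow> bool" where
  "is_ideal D I \<longleftrightarrow> I \<subseteq> D \<and> rgen D I = I"

definition zariski :: "'k set topology" where
  "zariski = topology_generated_by {{T. F \<subseteq> T} | F. finite F}"

definition pre_jaffard :: "'k::field set \<Rightarrow> 'k set set \<Rightarrow> bool" where
  "pre_jaffard D \<Theta> \<longleftrightarrow>
     (\<forall>T\<in>\<Theta>. overring D T) \<and>
     (\<Theta> = {UNIV} \<or> UNIV \<notin> \<Theta>) \<and>
     (\<forall>T\<in>\<Theta>. flat_over D T) \<and>
     (\<forall>I. is_ideal D I \<longrightarrow> I = (\<Inter>T\<in>\<Theta>. rgen T I)) \<and>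
     (\<forall>T\<in>\<Theta>. \<forall>T'\<in>\<Theta>. T \<noteq> T' \<longrightarrow> rgen T T' = UNIV) \<and>
     compactin zariski \<Theta>"

definition jaffard :: "'k::field set \<Rightarrow> 'k set set \<Rightarrow> bool" where
  "jaffard D \<Theta> \<longleftrightarrow> pre_jaffard D \<Theta> \<and>
     (\<forall>x\<in>D. x \<noteq> 0 \<longrightarrow> finite {T\<in>\<Theta>. inverse x \<notin> T})"

definition IntPoly :: "'k::field set \<Rightarrow> 'k poly set" where
  "IntPoly A = {f. \<forall>a\<in>A. poly f a \<in> A}"

text \<open>Int(A) viewed inside the field K(X) (= 'k poly fract), its quotient field.\<close>
definition IntF :: "'k::field set \<Rightarrow> 'k poly fract set" where
  "IntF A = (\<lambda>f. Fract f 1) ` IntPoly A"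

definition constK :: "'k::field \<Rightarrow> 'k poly fract" where
  "constK a = Fract [:a:] 1"

definition PicTheta :: "'k::field set \<Rightarrow> 'k set set \<Rightarrow> 'k set set monoid" where
  "PicTheta D \<Theta> = (Pic D)\<lparr>carrier := {C \<in> carrier (Pic D).
       \<forall>I\<in>C. \<forall>T\<in>\<Theta>. principal_ideal T (rgen T I)}\<rparr>"

definition map1 :: "'k::field set \<Rightarrow> 'k set set \<Rightarrow> 'k poly fract set set" where
  "map1 D = induced (IntF D) (\<lambda>I. rgen (IntF D) (constK ` I))"

definition map2 :: "'k::field set \<Rightarrow> 'k set set \<Rightarrow> 'k poly fract set set \<Rightarrow> 'k set \<Rightarrow> 'k poly fract set set" where
  "map2 D \<Theta> C = (\<lambda>T\<in>\<Theta>. induced (IntF T) (\<lambda>J. rgen (IntF T) J) C)"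

end

theory Submission
  imports Defs
begin

text \<open>An ideal of \<open>Int(D)\<close> can be scaled into \<open>K[X]\<close> so that it generates the unit ideal there. For
  such ideals everything is governed by constants: by Chinese remaindering, for \<open>T \<in> \<Theta>\<close> and
  \<open>0 \<noteq> d \<in> D\<close> there is \<open>e \<in> D\<close> with \<open>1 - e \<in> dT\<close> and \<open>e \<in> dT'\<close> for all other members \<open>T'\<close>.
  Multiplying by such \<open>e\<close> shows that a normalized ideal is determined by its local extensions, and that
  compatible local ideals \<open>J\<^sub>T\<close> are the extensions of their intersection, which gives surjectivity. If all
  local extensions are principal, their generators must be constants, so the ideal is extended from
  its intersection with \<open>K\<close>, which gives exactness in the middle. The first map is injective since a
  generator of \<open>I Int(D)\<close> divides a nonzero constant and hence is itself constant.\<close>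

section \<open>Submodules of a field\<close>

text \<open>The members of \<open>\<Theta>\<close> are flat overrings and need not be rings of
  fractions of \<open>D\<close>, so an element of Int(T) need not be carried into Int(D) by a single
  denominator that is a unit of \<open>T\<close>. The elements \<open>e\<close> take over this role:
  modulo \<open>d\<close> they are 1 at \<open>T\<close> and 0 at every other member. Any
  \<open>x\<close> splits as \<open>e * x + (1 - e) * x\<close>, where the first summand is harmless
  away from \<open>T\<close> and the second is divisible by \<open>d\<close> at \<open>T\<close>.
  Independence and flatness provide comaximality for two members, local finiteness extends it to all
  of them. Such constants control an ideal only if it contains a nonzero constant, which fails for X
  Int(D). The scaling repairs this, and it exists because K[X] is a principal ideal domain. The
  constant \<open>d\<close> found in the scaled ideal and in its inverse is used twice more: where
  it is a unit of \<open>T\<close> the local extension is trivial, which bounds the support of a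
  class; and for a finitely supported family of local classes the product of the constants on the
  support is one constant for all members, as gluing requires.\<close>

definition submod :: "'f::field set \<Rightarrow> 'f set \<Rightarrow> bool" where
  "submod R M \<longleftrightarrow> 0 \<in> M \<and> (\<forall>x\<in>M. \<forall>y\<in>M. x + y \<in> M) \<and> (\<forall>r\<in>R. \<forall>x\<in>M. r * x \<in> M)"

lemma submodI:
  "0 \<in> M \<Longrightarrow> (\<And>x y. x \<in> M \<Longrightarrow> y \<in> M \<Longrightarrow> x + y \<in> M)
    \<Longrightarrow> (\<And>r x. r \<in> R \<Longrightarrow> x \<in> M \<Longrightarrow> r * x \<in> M) \<Longrightarrow> submod R M"
  by (auto simp: submod_def)

lemma submod_zero: "submod R M \<Longrightarrow> 0 \<in> M"
  and submod_add: "submod R M \<Longrightarrow> x \<in> M \<Longrightarrow> y \<in> M \<Longrightarrow> x + y \<in> M"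
  and submod_scale: "submod R M \<Longrightarrow> r \<in> R \<Longrightarrow> x \<in> M \<Longrightarrow> r * x \<in> M"
  by (auto simp: submod_def)

lemma submod_sum: "submod R M \<Longrightarrow> (\<And>i. i \<in> S \<Longrightarrow> f i \<in> M) \<Longrightarrow> sum f S \<in> M"
  by (induction S rule: infinite_finite_induct) (auto simp: submod_def)

lemma submod_antimono: "submod R' M \<Longrightarrow> R \<subseteq> R' \<Longrightarrow> submod R M"
  by (auto simp: submod_def)

lemma subring_zero: "is_subring R \<Longrightarrow> 0 \<in> R"
  and subring_one: "is_subring R \<Longrightarrow> 1 \<in> R"
  and subring_add: "is_subring R \<Longrightarrow> x \<in> R \<Longrightarrow> y \<in> R \<Longrightarrow> x + y \<in> R"
  and subring_uminus: "is_subring R \<Longrightarrow> x \<in> R \<Longrightarrow> - x \<in> R"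
  and subring_mult: "is_subring R \<Longrightarrow> x \<in> R \<Longrightarrow> y \<in> R \<Longrightarrow> x * y \<in> R"
  by (auto simp: is_subring_def)

lemma subring_diff: "is_subring R \<Longrightarrow> x \<in> R \<Longrightarrow> y \<in> R \<Longrightarrow> x - y \<in> R"
  using subring_add subring_uminus by (metis diff_conv_add_uminus)

lemma submod_self: "is_subring R \<Longrightarrow> submod R R"
  by (auto simp: submod_def is_subring_def)

lemma rgen_subset:
  assumes "submod R M" "S \<subseteq> M"
  shows "rgen R S \<subseteq> M"
  using assms unfolding rgen_def by (auto intro!: submod_sum simp: submod_def subset_iff)

lemma rgen_mult_mem: "r \<in> R \<Longrightarrow> s \<in> S \<Longrightarrow> r * s \<in> rgen R S"
  unfolding rgen_def by (rule CollectI, rule exI[of _ 1], rule exI[of _ "\<lambda>_. r"], rule exI[of _ "\<lambda>_. s"]) auto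

lemma rgen_superset: "is_subring R \<Longrightarrow> S \<subseteq> rgen R S"
  using rgen_mult_mem[of 1 R] by (auto simp: is_subring_def)

lemma rgenD:
  assumes "x \<in> rgen R S"
  obtains n :: nat and r s where "x = (\<Sum>i<n. r i * s i)" "\<forall>i<n. r i \<in> R \<and> s i \<in> S"
  using assms by (auto simp: rgen_def)

lemma submod_rgen:
  assumes "is_subring R"
  shows "submod R (rgen R S)"
proof (rule submodI)
  show "0 \<in> rgen R S"
    unfolding rgen_def by (rule CollectI, rule exI[of _ 0]) auto
next
  fix x y assume "x \<in> rgen R S" "y \<in> rgen R S"
  then obtain n m :: nat and r s r' s'
    where x: "x = (\<Sum>i<n. r i * s i)" "\<forall>i<n. r i \<in> R \<and> s i \<in> S"
      and y: "y = (\<Sum>i<m. r' i * s' i)" "\<forall>i<m. r' i \<in> R \<and> s' i \<in> S"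
    by (elim rgenD)
  define q where "q i = (if i < n then r i else r' (i - n))" for i
  define u where "u i = (if i < n then s i else s' (i - n))" for i
  have "(\<Sum>i<n + m. q i * u i) = (\<Sum>i<n. q i * u i) + (\<Sum>i<m. q (n + i) * u (n + i))"
    by (induction m) (auto simp: add.assoc)
  then have "x + y = (\<Sum>i<n + m. q i * u i)"
    using x y by (simp add: q_def u_def)
  moreover have "\<forall>i<n + m. q i \<in> R \<and> u i \<in> S"
    using x y by (auto simp: q_def u_def)
  ultimately show "x + y \<in> rgen R S"
    unfolding rgen_def by blast
next
  fix c x assume c: "c \<in> R" and "x \<in> rgen R S"
  then obtain n :: nat and r s where x: "x = (\<Sum>i<n. r i * s i)" "\<forall>i<n. r i \<in> R \<and> s i \<in> S"
    by (elim rgenD)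
  have "c * x = (\<Sum>i<n. (c * r i) * s i)"
    by (simp add: x sum_distrib_left mult.assoc)
  moreover have "\<forall>i<n. c * r i \<in> R \<and> s i \<in> S"
    using x c assms by (auto simp: is_subring_def)
  ultimately show "c * x \<in> rgen R S"
    unfolding rgen_def by (intro CollectI exI[of _ n] exI[of _ "\<lambda>i. c * r i"] exI[of _ s]) auto
qed

lemma rgen_eq_self_iff: "is_subring R \<Longrightarrow> rgen R M = M \<longleftrightarrow> submod R M"
  using submod_rgen[of R M] rgen_subset[of R M M] rgen_superset[of R M] by auto

lemma rgen_mono: "is_subring R \<Longrightarrow> S \<subseteq> rgen R S' \<Longrightarrow> rgen R S \<subseteq> rgen R S'"
  by (intro rgen_subset submod_rgen)

text \<open>Adding one summand at a time suits predicates such as "some nonzero constant carries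
  \<open>x\<close> into \<open>J\<close>", where the witness for \<open>r * s + y\<close> is the
  product of one for \<open>r\<close> and one for \<open>y\<close>.\<close>

lemma rgen_induct [consumes 1, case_names zero step]:
  assumes "x \<in> rgen R S" "P 0" "\<And>r s y. r \<in> R \<Longrightarrow> s \<in> S \<Longrightarrow> P y \<Longrightarrow> P (r * s + y)"
  shows "P x"
proof -
  obtain n :: nat and r s where x: "x = (\<Sum>i<n. r i * s i)" "\<forall>i<n. r i \<in> R \<and> s i \<in> S"
    using assms(1) by (elim rgenD)
  have "P (\<Sum>i<m. r i * s i)" if "m \<le> n" for m
    using that
  proof (induction m)
    case (Suc m)
    then show ?case
      using assms(3)[of "r m" "s m" "\<Sum>i<m. r i * s i"] x by (simp add: add.commute)
  qed (simp add: assms(2))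
  then show ?thesis by (simp add: x)
qed

lemma rgen_rgen:
  assumes "is_subring R" "is_subring R'" "R \<subseteq> R'"
  shows "rgen R' (rgen R S) = rgen R' S"
proof
  show "rgen R' (rgen R S) \<subseteq> rgen R' S"
    by (intro rgen_subset submod_rgen submod_antimono[OF submod_rgen] assms rgen_superset)
  show "rgen R' S \<subseteq> rgen R' (rgen R S)"
    using assms by (meson order_trans rgen_mono rgen_superset)
qed

lemma ideal_prod_subset:
  "submod R M \<Longrightarrow> (\<And>a b. a \<in> I \<Longrightarrow> b \<in> J \<Longrightarrow> a * b \<in> M) \<Longrightarrow> ideal_prod R I J \<subseteq> M"
  unfolding ideal_prod_def by (rule rgen_subset) auto

lemma submod_ideal_prod: "is_subring R \<Longrightarrow> submod R (ideal_prod R I J)"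
  unfolding ideal_prod_def by (rule submod_rgen)

lemma ideal_prod_mem: "is_subring R \<Longrightarrow> a \<in> I \<Longrightarrow> b \<in> J \<Longrightarrow> a * b \<in> ideal_prod R I J"
  unfolding ideal_prod_def by (rule subsetD[OF rgen_superset]) auto

text \<open>This is the colon module (M : J). Because it is a submodule, a claim that all products
  of two modules lie in \<open>M\<close> has to be checked on generators only.\<close>

lemma submod_quotient:
  assumes "submod R M"
  shows "submod R {x. \<forall>b\<in>J. x * b \<in> M}"
  by (rule submodI)
     (auto simp: distrib_right mult.assoc intro: submod_zero[OF assms] submod_add[OF assms]
        submod_scale[OF assms])

lemma ideal_prod_commute:
  fixes I J :: "'f::field set"
  shows "ideal_prod R I J = ideal_prod R J I"
proof -
  have sub: "{a * b | a b. a \<in> I \<and> b \<in> J} \<subseteq> {a * b | a b. a \<in> J \<and> b \<in> I}" for I J :: "'f set"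
  proof clarify
    fix a b assume "a \<in> I" "b \<in> J"
    then show "\<exists>a' b'. a * b = a' * b' \<and> a' \<in> J \<and> b' \<in> I"
      by (intro exI[of _ b] exI[of _ a]) simp
  qed
  have "{a * b | a b. a \<in> I \<and> b \<in> J} = {a * b | a b. a \<in> J \<and> b \<in> I}"
    by (rule subset_antisym[OF sub sub])
  then show ?thesis
    by (simp only: ideal_prod_def)
qed

lemma ideal_prod_rgen:
  assumes "is_subring R"
  shows "ideal_prod R (rgen R I) (rgen R J) = ideal_prod R I J"
proof
  have "rgen R I \<subseteq> {x. \<forall>b\<in>J. x * b \<in> ideal_prod R I J}"
    by (intro rgen_subset submod_quotient submod_ideal_prod assms) (auto intro: ideal_prod_mem assms)
  moreover have "rgen R J \<subseteq> {b. \<forall>a\<in>rgen R I. b * a \<in> ideal_prod R I J}"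
    using calculation
    by (intro rgen_subset submod_quotient submod_ideal_prod assms subsetI CollectI ballI)
       (subst mult.commute, blast)
  ultimately have "b * a \<in> ideal_prod R I J" if "a \<in> rgen R I" "b \<in> rgen R J" for a b
    using that by blast
  then show "ideal_prod R (rgen R I) (rgen R J) \<subseteq> ideal_prod R I J"
    by (intro ideal_prod_subset submod_ideal_prod assms) (subst mult.commute)
  show "ideal_prod R I J \<subseteq> ideal_prod R (rgen R I) (rgen R J)"
    using rgen_superset[OF assms]
    by (intro ideal_prod_subset submod_ideal_prod ideal_prod_mem assms) auto
qed

lemma ideal_prod_assoc_subset:
  assumes "is_subring R"
  shows "ideal_prod R (ideal_prod R I J) L \<subseteq> ideal_prod R I (ideal_prod R J L)"
proof -
  have "ideal_prod R I J \<subseteq> {x. \<forall>b\<in>L. x * b \<in> ideal_prod R I (ideal_prod R J L)}"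
    by (intro ideal_prod_subset submod_quotient submod_ideal_prod assms)
       (auto simp: mult.assoc intro!: ideal_prod_mem assms)
  then show ?thesis
    by (intro ideal_prod_subset submod_ideal_prod assms) auto
qed

lemma ideal_prod_assoc:
  assumes "is_subring R"
  shows "ideal_prod R (ideal_prod R I J) L = ideal_prod R I (ideal_prod R J L)"
proof (rule subset_antisym)
  \<comment> \<open>With \<open>I\<close> and \<open>L\<close> exchanged, the inclusion already
    proved becomes this one by commutativity.\<close>
  show "ideal_prod R I (ideal_prod R J L) \<subseteq> ideal_prod R (ideal_prod R I J) L"
    using ideal_prod_assoc_subset[OF assms, of L J I]
    by (simp only: ideal_prod_commute[of R L] ideal_prod_commute[of R _ I] ideal_prod_commute[of R J I])
qed (rule ideal_prod_assoc_subset[OF assms])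

lemma ideal_prod_one:
  assumes "is_subring R" "submod R I"
  shows "ideal_prod R R I = I"
proof
  show "ideal_prod R R I \<subseteq> I"
    using assms by (intro ideal_prod_subset) (auto simp: submod_def)
  show "I \<subseteq> ideal_prod R R I"
    using ideal_prod_mem[OF assms(1) subring_one[OF assms(1)], of _ I] by (auto simp: subset_iff)
qed

section \<open>Invertible ideals and the Picard group\<close>

lemma qf_subring: "domain_with_qf R \<Longrightarrow> is_subring R"
  by (simp add: domain_with_qf_def)

lemma qf_den:
  assumes "domain_with_qf R"
  obtains b where "b \<in> R" "b \<noteq> 0" "b * x \<in> R"
proof -
  obtain a b where "a \<in> R" "b \<in> R" "b \<noteq> 0" "x = a / b"
    using assms unfolding domain_with_qf_def by blast
  then show thesis
    by (intro that[of b]) auto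
qed

text \<open>A relation IJ = R forces both factors to be fractional: a nonzero \<open>y\<close> in
  \<open>J\<close> satisfies yI \<subseteq> R, and some nonzero \<open>b\<close> in \<open>R\<close>
  carries \<open>y\<close> into \<open>R\<close>, so \<open>b * y\<close> is a common denominator of
  \<open>I\<close>.\<close>

lemma invertible_ideal_iff:
  assumes R: "domain_with_qf R"
  shows "invertible_ideal R I \<longleftrightarrow> submod R I \<and> (\<exists>J. submod R J \<and> ideal_prod R I J = R)"
proof
  note S = qf_subring[OF R]
  show "invertible_ideal R I \<Longrightarrow> submod R I \<and> (\<exists>J. submod R J \<and> ideal_prod R I J = R)"
    unfolding invertible_ideal_def frac_ideal_def using rgen_eq_self_iff[OF S] by blast
  have frac: "frac_ideal R I" if I: "submod R I" and J: "submod R J" and IJ: "ideal_prod R I J = R" for I J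
  proof -
    have nz: "\<exists>y\<in>J. y \<noteq> 0" if "ideal_prod R I J = R" for I J
    proof (rule ccontr)
      assume "\<not> ?thesis"
      then have "ideal_prod R I J \<subseteq> {0}"
        by (intro ideal_prod_subset) (auto simp: submod_def)
      then show False
        using subring_one[OF S] that by auto
    qed
    obtain y where y: "y \<in> J" "y \<noteq> 0"
      using nz[OF IJ] by blast
    obtain x where x: "x \<in> I" "x \<noteq> 0"
      using nz[of J I] IJ ideal_prod_commute by metis
    obtain b where b: "b \<in> R" "b \<noteq> 0" "b * y \<in> R"
      using qf_den[OF R] .
    have "b * y * z \<in> R" if "z \<in> I" for z
    proof -
      have "b * (z * y) \<in> R"
        using ideal_prod_mem[OF S that y(1)] IJ subring_mult[OF S b(1)] by simp
      then show ?thesis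
        by (simp add: mult_ac)
    qed
    then show ?thesis
      unfolding frac_ideal_def using I x y b rgen_eq_self_iff[OF S]
      by (intro conjI bexI[of _ "b * y"]) auto
  qed
  assume "submod R I \<and> (\<exists>J. submod R J \<and> ideal_prod R I J = R)"
  then obtain J where J: "submod R I" "submod R J" "ideal_prod R I J = R"
    by blast
  moreover have "ideal_prod R J I = R"
    using J ideal_prod_commute[of R I J] by simp
  ultimately show "invertible_ideal R I"
    unfolding invertible_ideal_def using frac by blast
qed

lemma submod_scaled:
  assumes "submod R I"
  shows "submod R ((\<lambda>r. x * r) ` I)"
proof (rule submodI)
  show "0 \<in> (\<lambda>r. x * r) ` I"
    by (rule image_eqI[where x = 0]) (simp_all add: submod_zero[OF assms])
next
  fix a b assume "a \<in> (\<lambda>r. x * r) ` I" "b \<in> (\<lambda>r. x * r) ` I"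
  then obtain u v where "a = x * u" "b = x * v" "u \<in> I" "v \<in> I"
    by blast
  then show "a + b \<in> (\<lambda>r. x * r) ` I"
    by (intro image_eqI[where x = "u + v"]) (simp_all add: distrib_left submod_add[OF assms])
next
  fix a b assume "a \<in> R" "b \<in> (\<lambda>r. x * r) ` I"
  then obtain u where "b = x * u" "u \<in> I"
    by blast
  then show "a * b \<in> (\<lambda>r. x * r) ` I"
    using \<open>a \<in> R\<close>
    by (intro image_eqI[where x = "a * u"]) (simp_all add: mult.left_commute submod_scale[OF assms])
qed

lemma submod_principal: "is_subring R \<Longrightarrow> submod R ((\<lambda>r. x * r) ` R)"
  by (intro submod_scaled submod_self)

lemma ideal_prod_principal:
  assumes "is_subring R" "submod R I"
  shows "ideal_prod R ((\<lambda>r. x * r) ` R) I = (\<lambda>r. x * r) ` I"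
proof
  show "ideal_prod R ((\<lambda>r. x * r) ` R) I \<subseteq> (\<lambda>r. x * r) ` I"
    using assms submod_scale[OF assms(2)]
    by (intro ideal_prod_subset submod_scaled) (auto simp: mult.assoc)
  have "x \<in> (\<lambda>r. x * r) ` R"
    using subring_one[OF assms(1)] by force
  then show "(\<lambda>r. x * r) ` I \<subseteq> ideal_prod R ((\<lambda>r. x * r) ` R) I"
    using ideal_prod_mem[OF assms(1)] by fastforce
qed

lemma principal_invertible:
  assumes R: "domain_with_qf R" and "principal_ideal R I"
  shows "invertible_ideal R I"
proof -
  note S = qf_subring[OF R]
  obtain x where x: "x \<noteq> 0" "I = (\<lambda>r. x * r) ` R"
    using assms(2) by (auto simp: principal_ideal_def)
  have "ideal_prod R I ((\<lambda>r. inverse x * r) ` R) = R"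
    using x by (simp add: ideal_prod_principal[OF S] submod_principal[OF S] image_image
        flip: mult.assoc)
  moreover have "submod R I"
    using x(2) submod_principal[OF S] by simp
  ultimately show ?thesis
    using submod_principal[OF S] by (subst invertible_ideal_iff[OF R]) blast
qed

lemma principal_ideal_self: "is_subring R \<Longrightarrow> principal_ideal R R"
  unfolding principal_ideal_def by (intro exI[of _ 1]) auto

lemma invertible_ideal_prod:
  assumes R: "domain_with_qf R" and "invertible_ideal R I" "invertible_ideal R J"
  shows "invertible_ideal R (ideal_prod R I J)"
proof -
  note S = qf_subring[OF R]
  obtain I' J' where IJ: "submod R I'" "ideal_prod R I I' = R" "submod R J'" "ideal_prod R J J' = R"
    using assms by (auto simp: invertible_ideal_iff[OF R])
  have "ideal_prod R (ideal_prod R I J) (ideal_prod R J' I')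
      = ideal_prod R I (ideal_prod R (ideal_prod R J J') I')"
    by (simp add: ideal_prod_assoc[OF S])
  also have "\<dots> = R"
    using IJ by (simp add: ideal_prod_one[OF S])
  finally show ?thesis
    using submod_ideal_prod[OF S] by (subst invertible_ideal_iff[OF R]) blast
qed

lemma InvIdeals_simps [simp]:
  "carrier (InvIdeals R) = {I. invertible_ideal R I}"
  "mult (InvIdeals R) = ideal_prod R" "one (InvIdeals R) = R"
  by (simp_all add: InvIdeals_def)

lemma comm_group_InvIdeals:
  assumes R: "domain_with_qf R"
  shows "comm_group (InvIdeals R)"
proof -
  note S = qf_subring[OF R]
  note inv = invertible_ideal_iff[OF R]
  have inv_R: "invertible_ideal R R"
    by (intro principal_invertible R principal_ideal_self S)
  have sub: "submod R I" if "invertible_ideal R I" for I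
    using that inv by blast
  show ?thesis
  proof (rule comm_groupI)
    fix I J assume "I \<in> carrier (InvIdeals R)" "J \<in> carrier (InvIdeals R)"
    then show "I \<otimes>\<^bsub>InvIdeals R\<^esub> J \<in> carrier (InvIdeals R)"
      using invertible_ideal_prod[OF R] by simp
    show "I \<otimes>\<^bsub>InvIdeals R\<^esub> J = J \<otimes>\<^bsub>InvIdeals R\<^esub> I"
      using ideal_prod_commute[of R I J] by simp
  next
    fix I assume "I \<in> carrier (InvIdeals R)"
    then obtain J where J: "submod R J" "ideal_prod R I J = R" "submod R I"
      using inv by auto
    then have JI: "ideal_prod R J I = R"
      using ideal_prod_commute[of R J I] by simp
    then have "invertible_ideal R J"
      using inv J by blast
    then show "\<exists>J\<in>carrier (InvIdeals R). J \<otimes>\<^bsub>InvIdeals R\<^esub> I = \<one>\<^bsub>InvIdeals R\<^esub>"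
      using JI by auto
    show "\<one>\<^bsub>InvIdeals R\<^esub> \<otimes>\<^bsub>InvIdeals R\<^esub> I = I"
      using ideal_prod_one[OF S J(3)] by simp
  qed (simp_all add: ideal_prod_assoc[OF S] inv_R)
qed

lemma principal_subgroup:
  assumes R: "domain_with_qf R"
  shows "subgroup {I. principal_ideal R I} (InvIdeals R)"
proof -
  interpret comm_group "InvIdeals R" by (rule comm_group_InvIdeals[OF R])
  note S = qf_subring[OF R]
  have prod: "ideal_prod R ((\<lambda>r. x * r) ` R) ((\<lambda>r. y * r) ` R) = (\<lambda>r. x * y * r) ` R" for x y
    by (simp add: ideal_prod_principal[OF S] submod_principal[OF S] image_image mult.assoc)
  show ?thesis
  proof (rule subgroupI)
    show "{I. principal_ideal R I} \<subseteq> carrier (InvIdeals R)"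
      using principal_invertible[OF R] by auto
    show "{I. principal_ideal R I} \<noteq> {}"
      using principal_ideal_self[OF S] by auto
  next
    fix I assume "I \<in> {I. principal_ideal R I}"
    then obtain x where x: "x \<noteq> 0" "I = (\<lambda>r. x * r) ` R"
      by (auto simp: principal_ideal_def)
    have pr: "principal_ideal R ((\<lambda>r. inverse x * r) ` R)"
      using x unfolding principal_ideal_def by (intro exI[of _ "inverse x"]) simp
    have "inv\<^bsub>InvIdeals R\<^esub> I = (\<lambda>r. inverse x * r) ` R"
    proof (rule inv_equality)
      show "(\<lambda>r. inverse x * r) ` R \<otimes>\<^bsub>InvIdeals R\<^esub> I = \<one>\<^bsub>InvIdeals R\<^esub>"
        using x by (simp add: prod)
    qed (use x pr principal_invertible[OF R] in \<open>auto simp: principal_ideal_def\<close>)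
    then show "inv\<^bsub>InvIdeals R\<^esub> I \<in> {I. principal_ideal R I}"
      using pr by simp
  next
    fix I J assume "I \<in> {I. principal_ideal R I}" "J \<in> {I. principal_ideal R I}"
    then obtain x y where "x \<noteq> 0" "I = (\<lambda>r. x * r) ` R" "y \<noteq> 0" "J = (\<lambda>r. y * r) ` R"
      by (auto simp: principal_ideal_def)
    then show "I \<otimes>\<^bsub>InvIdeals R\<^esub> J \<in> {I. principal_ideal R I}"
      by (auto simp: prod principal_ideal_def intro!: exI[of _ "x * y"])
  qed
qed

lemma principal_normal:
  assumes R: "domain_with_qf R"
  shows "{I. principal_ideal R I} \<lhd> InvIdeals R"
  using comm_group.subgroup_imp_normal[OF comm_group_InvIdeals[OF R] principal_subgroup[OF R]] .

lemma group_Pic: "domain_with_qf R \<Longrightarrow> group (Pic R)"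
  unfolding Pic_def by (rule normal.factorgroup_is_group[OF principal_normal])

abbreviation cls :: "'f::field set \<Rightarrow> 'f set \<Rightarrow> 'f set set" where
  "cls R I \<equiv> {J. principal_ideal R J} #>\<^bsub>InvIdeals R\<^esub> I"

lemma carrier_Pic: "carrier (Pic R) = cls R ` {I. invertible_ideal R I}"
  unfolding Pic_def FactGroup_def RCOSETS_def by auto

lemma one_Pic [simp]: "one (Pic R) = {I. principal_ideal R I}"
  by (simp add: Pic_def)

lemma mult_Pic:
  assumes "domain_with_qf R" "invertible_ideal R I" "invertible_ideal R J"
  shows "cls R I \<otimes>\<^bsub>Pic R\<^esub> cls R J = cls R (ideal_prod R I J)"
  using normal.rcos_sum[OF principal_normal[OF assms(1)], of I J] assms by (simp add: Pic_def)

lemma cls_eq_one_iff: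
  assumes "domain_with_qf R" "invertible_ideal R I"
  shows "cls R I = {J. principal_ideal R J} \<longleftrightarrow> principal_ideal R I"
  using group.coset_join1[OF comm_group.axioms(2)[OF comm_group_InvIdeals[OF assms(1)]] _ _ principal_subgroup[OF assms(1)], of I]
    group.coset_join2[OF comm_group.axioms(2)[OF comm_group_InvIdeals[OF assms(1)]] _ principal_subgroup[OF assms(1)], of I]
    assms by auto

lemma cls_self:
  assumes "domain_with_qf R" "invertible_ideal R I"
  shows "I \<in> cls R I"
  using group.rcos_self[OF comm_group.axioms(2)[OF comm_group_InvIdeals[OF assms(1)]] _
      principal_subgroup[OF assms(1)], of I] assms
  by simp

lemma mem_cls:
  assumes "domain_with_qf R" "invertible_ideal R I"
  shows "J \<in> cls R I \<longleftrightarrow> (\<exists>x. x \<noteq> 0 \<and> J = (\<lambda>r. x * r) ` I)"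
  using ideal_prod_principal[OF qf_subring[OF assms(1)], of I] assms invertible_ideal_iff[OF assms(1)]
  unfolding r_coset_def by (auto simp: principal_ideal_def)

lemma cls_eq:
  assumes "domain_with_qf R" "invertible_ideal R I" "J \<in> cls R I"
  shows "cls R J = cls R I"
  using group.repr_independence[OF comm_group.axioms(2)[OF comm_group_InvIdeals[OF assms(1)]] assms(3) _ principal_subgroup[OF assms(1)]] assms
  by simp

lemma cls_invertible:
  assumes "domain_with_qf R" "invertible_ideal R I" "J \<in> cls R I"
  shows "invertible_ideal R J"
  using invertible_ideal_prod[OF assms(1) principal_invertible[OF assms(1)] assms(2)] assms(3)
  by (auto simp: r_coset_def)

section \<open>Extension of ideals\<close>

text \<open>One setting for every base change that occurs: the inclusions of \<open>D\<close> in
  \<open>T\<close>, of Int(D) in Int(T) and of Int(A) in K[X], with \<open>k\<close> the identity,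
  and the constants of \<open>A\<close> in Int(A), with \<open>k = constK\<close>. The map
  \<open>k\<close> is a homomorphism of the whole fields, so fractional ideals and scalings by field
  elements are transported as well.\<close>

locale ring_ext =
  fixes k :: "'f::field \<Rightarrow> 'g::field" and R R'
  assumes R: "domain_with_qf R" and R': "domain_with_qf R'"
    and k_zero: "k 0 = 0" and k_one: "k 1 = 1"
    and k_add: "k (x + y) = k x + k y" and k_mult: "k (x * y) = k x * k y"
    and k_mem: "x \<in> R \<Longrightarrow> k x \<in> R'"
begin

abbreviation ext :: "'f set \<Rightarrow> 'g set" where "ext I \<equiv> rgen R' (k ` I)"

lemmas SR = qf_subring[OF R] and SR' = qf_subring[OF R']

lemma k_nonzero: "x \<noteq> 0 \<Longrightarrow> k x \<noteq> 0"
  using k_mult[of x "inverse x"] by (auto simp: k_one)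

lemma submod_vimage: "submod R' M \<Longrightarrow> submod R (k -` M)"
  by (auto simp: submod_def k_zero k_add k_mult k_mem)

lemma ext_rgen: "ext (rgen R S) = ext S"
proof
  have "rgen R S \<subseteq> k -` ext S"
    using rgen_superset[OF SR', of "k ` S"] by (intro rgen_subset submod_vimage submod_rgen SR') auto
  then show "ext (rgen R S) \<subseteq> ext S"
    by (intro rgen_mono SR') auto
  have "k ` S \<subseteq> k ` rgen R S"
    by (intro image_mono rgen_superset SR)
  then show "ext S \<subseteq> ext (rgen R S)"
    using rgen_superset[OF SR'] by (intro rgen_mono SR') blast
qed

lemma ext_prod: "ext (ideal_prod R I J) = ideal_prod R' (ext I) (ext J)"
proof -
  have "k ` {a * b | a b. a \<in> I \<and> b \<in> J} = {a * b | a b. a \<in> k ` I \<and> b \<in> k ` J}"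
    by (force simp: k_mult)
  then show ?thesis
    unfolding ideal_prod_rgen[OF SR'] by (simp add: ideal_prod_def ext_rgen)
qed

lemma ext_principal: "ext ((\<lambda>r. x * r) ` R) = (\<lambda>r. k x * r) ` R'"
proof
  show "ext ((\<lambda>r. x * r) ` R) \<subseteq> (\<lambda>r. k x * r) ` R'"
    by (intro rgen_subset submod_principal SR') (auto simp: k_mult k_mem)
  have "k x \<in> k ` (\<lambda>r. x * r) ` R"
    using subring_one[OF SR] by (force simp: image_image)
  then have "r * k x \<in> ext ((\<lambda>r. x * r) ` R)" if "r \<in> R'" for r
    using that by (intro rgen_mult_mem)
  then show "(\<lambda>r. k x * r) ` R' \<subseteq> ext ((\<lambda>r. x * r) ` R)"
    by (auto simp: mult.commute)
qed

lemma ext_self: "ext R = R'"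
  using ext_principal[of 1] by (simp add: k_one)

lemma ext_principal_ideal: "principal_ideal R I \<Longrightarrow> principal_ideal R' (ext I)"
  unfolding principal_ideal_def using ext_principal k_nonzero by blast

lemma ext_invertible: "invertible_ideal R I \<Longrightarrow> invertible_ideal R' (ext I)"
  unfolding invertible_ideal_iff[OF R] invertible_ideal_iff[OF R']
  using ext_prod ext_self submod_rgen[OF SR'] by metis

text \<open>Scaling by \<open>x\<close> is multiplication by the principal ideal \<open>xR\<close>,
  so this is an instance of multiplicativity of extension.\<close>

lemma ext_scaled: "submod R I \<Longrightarrow> ext ((\<lambda>r. x * r) ` I) = (\<lambda>r. k x * r) ` ext I"
  using ext_prod[of "(\<lambda>r. x * r) ` R" I]
  by (simp add: ideal_prod_principal[OF SR] ideal_prod_principal[OF SR'] ext_principal submod_rgen[OF SR'])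

text \<open>The union in \<open>induced\<close> runs over equal classes: two representatives differ
  by a factor \<open>x\<close>, hence their extensions by the factor \<open>k x\<close>.\<close>

lemma induced_cls:
  assumes I: "invertible_ideal R I"
  shows "induced R' ext (cls R I) = cls R' (ext I)"
proof -
  have "cls R' (ext J) = cls R' (ext I)" if J: "J \<in> cls R I" for J
  proof (rule cls_eq[OF R' ext_invertible[OF I]])
    obtain x where x: "x \<noteq> 0" "J = (\<lambda>r. x * r) ` I"
      using J mem_cls[OF R I] by auto
    then have "ext J = (\<lambda>r. k x * r) ` ext I"
      using I invertible_ideal_iff[OF R] ext_scaled by blast
    then show "ext J \<in> cls R' (ext I)"
      using mem_cls[OF R' ext_invertible[OF I]] x k_nonzero by blast
  qed
  then show ?thesis
    unfolding induced_def using cls_self[OF R I] by blast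
qed

lemma induced_hom: "induced R' ext \<in> hom (Pic R) (Pic R')"
proof (rule homI)
  fix C assume "C \<in> carrier (Pic R)"
  then show "induced R' ext C \<in> carrier (Pic R')"
    using induced_cls ext_invertible by (auto simp: carrier_Pic)
next
  fix C E assume "C \<in> carrier (Pic R)" "E \<in> carrier (Pic R)"
  then obtain I J where "invertible_ideal R I" "C = cls R I" "invertible_ideal R J" "E = cls R J"
    by (auto simp: carrier_Pic)
  then show "induced R' ext (C \<otimes>\<^bsub>Pic R\<^esub> E) = induced R' ext C \<otimes>\<^bsub>Pic R'\<^esub> induced R' ext E"
    by (simp add: mult_Pic[OF R] mult_Pic[OF R'] induced_cls ext_invertible invertible_ideal_prod[OF R] ext_prod)
qed

end

section \<open>Separating the members of a Jaffard family\<close>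

locale jaffard_family =
  fixes D :: "'k::field set" and \<Theta> :: "'k set set"
  assumes D: "domain_with_qf D" and jaffard: "jaffard D \<Theta>"
begin

lemmas SD = qf_subring[OF D]

lemma pre_jaffard: "pre_jaffard D \<Theta>"
  and Theta_locally_finite: "x \<in> D \<Longrightarrow> x \<noteq> 0 \<Longrightarrow> finite {T\<in>\<Theta>. inverse x \<notin> T}"
  using jaffard by (simp_all add: jaffard_def)

lemma Theta_subring: "T \<in> \<Theta> \<Longrightarrow> is_subring T"
  and Theta_superset: "T \<in> \<Theta> \<Longrightarrow> D \<subseteq> T"
  and Theta_flat: "T \<in> \<Theta> \<Longrightarrow> flat_over D T"
  and Theta_independent: "T \<in> \<Theta> \<Longrightarrow> T' \<in> \<Theta> \<Longrightarrow> T \<noteq> T' \<Longrightarrow> rgen T T' = UNIV"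
  using pre_jaffard by (simp_all add: pre_jaffard_def overring_def)

lemma complete:
  assumes "submod D I" "I \<subseteq> D" "\<And>T. T \<in> \<Theta> \<Longrightarrow> x \<in> rgen T I"
  shows "x \<in> I"
proof -
  have "is_ideal D I"
    using assms rgen_eq_self_iff[OF SD] by (auto simp: is_ideal_def)
  then have "I = (\<Inter>T\<in>\<Theta>. rgen T I)"
    using pre_jaffard unfolding pre_jaffard_def by (elim conjE) (rule mp, rule spec)
  then show ?thesis
    using assms(3) by blast
qed

lemma Theta_nonempty: "\<Theta> \<noteq> {}"
proof
  assume empty: "\<Theta> = {}"
  have "1 \<in> {0::'k}"
    by (rule complete) (auto simp: submod_def subring_zero[OF SD] empty)
  then show False by simp
qed

lemma Inter_Theta:
  assumes "\<And>T. T \<in> \<Theta> \<Longrightarrow> x \<in> T"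
  shows "x \<in> D"
proof (rule complete[OF submod_self[OF SD] order_refl])
  fix T assume "T \<in> \<Theta>"
  then show "x \<in> rgen T D"
    using rgen_mult_mem[OF assms subring_one[OF SD], of T] by simp
qed

lemma qf_overring:
  assumes "is_subring A" "D \<subseteq> A"
  shows "domain_with_qf A"
  using D assms unfolding domain_with_qf_def by blast

section \<open>Comaximality from flatness, independence and local finiteness\<close>

lemma common_denominator:
  assumes "finite S"
  obtains b where "b \<in> D" "b \<noteq> 0" "\<And>x. x \<in> S \<Longrightarrow> b * x \<in> D"
proof -
  have "\<exists>b\<in>D. b \<noteq> 0 \<and> (\<forall>x\<in>S. b * x \<in> D)"
    using assms
  proof induction
    case empty
    then show ?case
      using subring_one[OF SD] by (intro bexI[of _ 1]) auto
  next
    case (insert y S)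
    then obtain b where b: "b \<in> D" "b \<noteq> 0" "\<forall>x\<in>S. b * x \<in> D"
      by blast
    obtain c where c: "c \<in> D" "c \<noteq> 0" "c * y \<in> D"
      using qf_den[OF D] .
    have "c * b * x \<in> D" if "x \<in> insert y S" for x
    proof (cases "x = y")
      case True
      then show ?thesis
        using subring_mult[OF SD b(1) c(3)] by (simp add: mult_ac)
    next
      case False
      then have "b * x \<in> D" using that b(3) by blast
      then show ?thesis
        using subring_mult[OF SD c(1)] by (simp add: mult.assoc)
    qed
    then show ?case
      using b c subring_mult[OF SD] by (intro bexI[of _ "c * b"]) auto
  qed
  then show thesis using that by blast
qed

text \<open>The equational criterion is applied to the relation \<open>b = (\<Sum>i<n. (b * m i) * t i)\<close>, where
  \<open>1 = (\<Sum>i<n. t i * m i)\<close> and \<open>b\<close> is a common denominator of the \<open>m i\<close>.\<close>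

lemma flat_one_mem_rgen_Int:
  assumes T: "T \<in> \<Theta>" and M: "submod D M" and one: "1 \<in> rgen T M"
  shows "1 \<in> rgen T (M \<inter> D)"
proof -
  note ST = Theta_subring[OF T]
  obtain n :: nat and t m where tm: "1 = (\<Sum>i<n. t i * m i)" "\<forall>i<n. t i \<in> T \<and> m i \<in> M"
    using one by (elim rgenD)
  obtain b where b: "b \<in> D" "b \<noteq> 0" "\<And>x. x \<in> m ` {..<n} \<Longrightarrow> b * x \<in> D"
    using common_denominator[of "m ` {..<n}"] by blast
  \<comment> \<open>Slot 0 holds the left side \<open>b * 1\<close>, the later slots the negated
    right side, so that the sum vanishes. The criterion then expresses
    \<open>u 0 = 1\<close>.\<close>
  define r where "r i = (case i of 0 \<Rightarrow> b | Suc j \<Rightarrow> - (b * m j))" for i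
  define u where "u i = (case i of 0 \<Rightarrow> 1 | Suc j \<Rightarrow> t j)" for i
  have ru: "\<forall>i<Suc n. r i \<in> D \<and> u i \<in> T"
    using b tm subring_uminus[OF SD] subring_one[OF ST]
    by (auto simp: r_def u_def split: nat.split)
  have rel: "(\<Sum>i<Suc n. r i * u i) = 0"
  proof -
    have "(\<Sum>i<n. b * m i * t i) = b * (\<Sum>i<n. t i * m i)"
      by (simp add: sum_distrib_left mult_ac)
    then show ?thesis
      unfolding sum.lessThan_Suc_shift by (simp add: r_def u_def sum_negf flip: tm(1))
  qed
  obtain l :: nat and a m' where a: "\<forall>i<Suc n. \<forall>j<l. a i j \<in> D" "\<forall>j<l. m' j \<in> T"
      "\<forall>i<Suc n. u i = (\<Sum>j<l. a i j * m' j)" "\<forall>j<l. (\<Sum>i<Suc n. r i * a i j) = 0"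
    using Theta_flat[OF T, unfolded flat_over_def, THEN spec, of "Suc n", THEN spec, of r,
        THEN spec, of u, THEN mp, OF conjI[OF ru rel]]
    by (elim exE conjE) (rule that)
  \<comment> \<open>Column \<open>j\<close> of the criterion, divided by \<open>b\<close>, writes
    \<open>a 0 j\<close> as a \<open>D\<close>-combination of the \<open>m i\<close>. So these
    entries lie in \<open>M\<close> and in \<open>D\<close> at once, and row 0 combines them to 1
    over \<open>T\<close>.\<close>
  have "a 0 j \<in> M" if j: "j < l" for j
  proof -
    have "b * a 0 j - (\<Sum>i<n. b * m i * a (Suc i) j) = 0"
      using a(4) j unfolding sum.lessThan_Suc_shift by (simp add: r_def sum_negf)
    then have "b * a 0 j = b * (\<Sum>i<n. a (Suc i) j * m i)"
      by (simp add: sum_distrib_left mult_ac)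
    then have "a 0 j = (\<Sum>i<n. a (Suc i) j * m i)"
      using b(2) by simp
    then show ?thesis
      using a(1) tm(2) j by (auto intro!: submod_sum[OF M] submod_scale[OF M])
  qed
  then have "(\<Sum>j<l. m' j * a 0 j) \<in> rgen T (M \<inter> D)"
    using a(1,2) by (intro submod_sum[OF submod_rgen[OF ST]] rgen_mult_mem) auto
  also have "(\<Sum>j<l. m' j * a 0 j) = u 0"
    using a(3) by (simp add: mult.commute)
  finally show ?thesis by (simp add: u_def)
qed

lemma submod_divide:
  assumes "is_subring A" "D \<subseteq> A"
  shows "submod D {x. x / d \<in> A}"
  using assms subring_mult[OF assms(1)]
  by (intro submodI) (auto simp: add_divide_distrib subring_add subring_zero simp flip: times_divide_eq_right)

text \<open>The product IJ lies in the intersection, and IT = JT = T implies (IJ)T = T.\<close>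

lemma one_mem_rgen_Int:
  assumes T: "T \<in> \<Theta>" and "submod D I" "I \<subseteq> D" "submod D J" "J \<subseteq> D"
    and I: "1 \<in> rgen T I" and J: "1 \<in> rgen T J"
  shows "1 \<in> rgen T (I \<inter> J)"
proof -
  note ST = Theta_subring[OF T]
  have IJ: "a * b \<in> rgen T (I \<inter> J)" if "a \<in> I" "b \<in> J" for a b
  proof -
    have "a \<in> D" "b \<in> D"
      using that assms by blast+
    then have "b * a \<in> I" "a * b \<in> J"
      using that assms by (simp_all add: submod_scale)
    then have "a * b \<in> I \<inter> J"
      by (simp add: mult.commute)
    then show ?thesis
      by (rule subsetD[OF rgen_superset[OF ST]])
  qed
  have "rgen T I \<subseteq> {x. \<forall>b\<in>J. x * b \<in> rgen T (I \<inter> J)}"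
    by (intro rgen_subset submod_quotient submod_rgen ST) (auto intro: IJ)
  then have "J \<subseteq> rgen T (I \<inter> J)"
    using I by auto
  then show ?thesis
    using rgen_mono[OF ST] J by blast
qed

text \<open>Independence writes \<open>inverse d\<close> as a sum of products \<open>r * s\<close>
  with \<open>r \<in> T\<close> and \<open>s \<in> T'\<close>. Multiplying by \<open>d\<close> gives
  1 as a \<open>T\<close>-combination of elements \<open>d * s\<close> of \<open>dT'\<close>; these
  may lie outside \<open>D\<close>, and flatness replaces them by elements of
  \<open>D\<close>.\<close>

lemma independent_one_mem_rgen:
  assumes T: "T \<in> \<Theta>" and T': "T' \<in> \<Theta>" "T \<noteq> T'" and d: "d \<noteq> 0"
  shows "1 \<in> rgen T {x \<in> D. x / d \<in> T'}"
proof -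
  note ST = Theta_subring[OF T]
  have "d * y \<in> rgen T {x. x / d \<in> T'}" if "y \<in> rgen T T'" for y
    using that
  proof (induction rule: rgen_induct)
    case zero
    then show ?case
      using submod_zero[OF submod_rgen[OF ST]] by simp
  next
    case (step r s y)
    have "r * (d * s) \<in> rgen T {x. x / d \<in> T'}"
      using step d by (intro rgen_mult_mem) auto
    from submod_add[OF submod_rgen[OF ST] this step.IH] show ?case
      by (simp add: distrib_left mult.left_commute)
  qed
  from this[of "inverse d"] have "1 \<in> rgen T {x. x / d \<in> T'}"
    by (simp add: Theta_independent[OF T T'] d)
  then have "1 \<in> rgen T ({x. x / d \<in> T'} \<inter> D)"
    using T' Theta_subring Theta_superset
    by (intro flat_one_mem_rgen_Int[OF T] submod_divide) auto
  moreover have "{x. x / d \<in> T'} \<inter> D = {x \<in> D. x / d \<in> T'}"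
    by auto
  ultimately show ?thesis by simp
qed

lemma submod_others:
  assumes "\<F> \<subseteq> \<Theta>"
  shows "submod D {x \<in> D. \<forall>T'\<in>\<F>. x / d \<in> T'}"
proof -
  have sub: "submod D {x. x / d \<in> T'}" if "T' \<in> \<F>" for T'
    using that assms Theta_subring Theta_superset by (intro submod_divide) auto
  show ?thesis
  proof (rule submodI)
    show "0 \<in> {x \<in> D. \<forall>T'\<in>\<F>. x / d \<in> T'}"
      using submod_zero[OF sub] subring_zero[OF SD] by simp
  next
    fix x y assume "x \<in> {x \<in> D. \<forall>T'\<in>\<F>. x / d \<in> T'}" "y \<in> {x \<in> D. \<forall>T'\<in>\<F>. x / d \<in> T'}"
    then show "x + y \<in> {x \<in> D. \<forall>T'\<in>\<F>. x / d \<in> T'}"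
      using submod_add[OF sub] subring_add[OF SD] by simp
  next
    fix r x assume "r \<in> D" "x \<in> {x \<in> D. \<forall>T'\<in>\<F>. x / d \<in> T'}"
    then show "r * x \<in> {x \<in> D. \<forall>T'\<in>\<F>. x / d \<in> T'}"
      using submod_scale[OF sub] subring_mult[OF SD] by simp
  qed
qed

text \<open>Where \<open>d\<close> is a unit of \<open>T'\<close>, the condition
  \<open>x / d \<in> T'\<close> holds for every \<open>x \<in> D\<close>. By local finiteness only
  finitely many conditions remain, and they are intersected one at a time.\<close>

lemma others_one_mem_rgen:
  assumes T: "T \<in> \<Theta>" and d: "d \<in> D" "d \<noteq> 0"
  shows "1 \<in> rgen T {x \<in> D. \<forall>T'\<in>\<Theta> - {T}. x / d \<in> T'}"
proof -
  note ST = Theta_subring[OF T]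
  have finite_case: "1 \<in> rgen T {x \<in> D. \<forall>T'\<in>\<F>. x / d \<in> T'}" if "finite \<F>" "\<F> \<subseteq> \<Theta> - {T}" for \<F>
    using that
  proof induction
    case empty
    then show ?case
      using rgen_superset[OF ST] subring_one[OF SD] by auto
  next
    case (insert T' \<F>)
    have "1 \<in> rgen T ({x \<in> D. x / d \<in> T'} \<inter> {x \<in> D. \<forall>T'\<in>\<F>. x / d \<in> T'})"
    proof (rule one_mem_rgen_Int[OF T])
      show "submod D {x \<in> D. x / d \<in> T'}"
        using submod_others[of "{T'}" d] insert.prems by auto
      show "submod D {x \<in> D. \<forall>T'\<in>\<F>. x / d \<in> T'}"
        using insert.prems by (intro submod_others) auto
      show "1 \<in> rgen T {x \<in> D. x / d \<in> T'}"
        using insert.prems d by (intro independent_one_mem_rgen T) auto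
    qed (use insert in auto)
    moreover have "{x \<in> D. x / d \<in> T'} \<inter> {x \<in> D. \<forall>T'\<in>\<F>. x / d \<in> T'} = {x \<in> D. \<forall>T'\<in>insert T' \<F>. x / d \<in> T'}"
      by auto
    ultimately show ?case by simp
  qed
  define \<F> where "\<F> = {T'\<in>\<Theta> - {T}. inverse d \<notin> T'}"
  have "finite \<F>"
    by (rule finite_subset[OF _ Theta_locally_finite[OF d]]) (auto simp: \<F>_def)
  moreover have "x / d \<in> T'" if "x \<in> D" "T' \<in> \<Theta> - {T}" "T' \<notin> \<F>" for x T'
    using that subring_mult[of T' x "inverse d"] Theta_subring Theta_superset
    by (auto simp: \<F>_def divide_inverse)
  then have "{x \<in> D. \<forall>T'\<in>\<F>. x / d \<in> T'} = {x \<in> D. \<forall>T'\<in>\<Theta> - {T}. x / d \<in> T'}"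
    by (auto simp: \<F>_def)
  ultimately show ?thesis
    using finite_case[of \<F>] by (auto simp: \<F>_def)
qed

text \<open>Chinese remainder: the ideals \<open>D \<inter> dT\<close> and \<open>D \<inter> (\<Inter>T'\<noteq>T. dT')\<close> are comaximal, since
  for every member of the family one of the two extends to the whole ring.\<close>

lemma separation:
  assumes T: "T \<in> \<Theta>" and d: "d \<in> D" "d \<noteq> 0"
  obtains e where "e \<in> D" "(1 - e) / d \<in> T" "\<And>T'. T' \<in> \<Theta> \<Longrightarrow> T' \<noteq> T \<Longrightarrow> e / d \<in> T'"
proof -
  define I where "I = {x \<in> D. \<forall>T'\<in>\<Theta> - {T}. x / d \<in> T'}"
  define J where "J = {x \<in> D. x / d \<in> T}"
  have I: "submod D I"
    unfolding I_def by (rule submod_others) auto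
  have J: "submod D J"
    unfolding J_def using submod_others[of "{T}" d] T by auto
  have "1 \<in> {x + y | x y. x \<in> I \<and> y \<in> J}" (is "_ \<in> ?S")
  proof (rule complete)
    show "submod D ?S"
    proof (rule submodI)
      show "0 \<in> ?S"
        using submod_zero[OF I] submod_zero[OF J] by force
    next
      fix a b assume "a \<in> ?S" "b \<in> ?S"
      then obtain x y x' y' where "a = x + y" "b = x' + y'" "x \<in> I" "y \<in> J" "x' \<in> I" "y' \<in> J"
        by blast
      then show "a + b \<in> ?S"
        using submod_add[OF I] submod_add[OF J]
        by (intro CollectI exI[of _ "x + x'"] exI[of _ "y + y'"]) simp
    next
      fix r a assume "r \<in> D" "a \<in> ?S"
      then obtain x y where "a = x + y" "x \<in> I" "y \<in> J"
        by blast
      then show "r * a \<in> ?S"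
        using submod_scale[OF I] submod_scale[OF J] \<open>r \<in> D\<close>
        by (intro CollectI exI[of _ "r * x"] exI[of _ "r * y"]) (simp add: distrib_left)
    qed
    show "?S \<subseteq> D"
      using subring_add[OF SD] by (auto simp: I_def J_def)
    have "I \<subseteq> ?S"
    proof
      fix x assume "x \<in> I"
      then show "x \<in> ?S"
        using submod_zero[OF J] by (intro CollectI exI[of _ x] exI[of _ 0]) simp
    qed
    have "J \<subseteq> ?S"
    proof
      fix y assume "y \<in> J"
      then show "y \<in> ?S"
        using submod_zero[OF I] by (intro CollectI exI[of _ 0] exI[of _ y]) simp
    qed
    fix T' assume T': "T' \<in> \<Theta>"
    note ST' = Theta_subring[OF T']
    show "1 \<in> rgen T' ?S"
    proof (cases "T' = T")
      case True
      have "1 \<in> rgen T I"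
        unfolding I_def by (rule others_one_mem_rgen[OF T d])
      moreover have "rgen T I \<subseteq> rgen T ?S"
        using rgen_superset[OF Theta_subring[OF T], of ?S] \<open>I \<subseteq> ?S\<close>
        by (intro rgen_mono Theta_subring T) blast
      ultimately show ?thesis
        using True by blast
    next
      case False
      then have "1 \<in> rgen T' J"
        unfolding J_def by (intro independent_one_mem_rgen T T' d)
      moreover have "rgen T' J \<subseteq> rgen T' ?S"
        using rgen_superset[OF ST', of ?S] \<open>J \<subseteq> ?S\<close> by (intro rgen_mono ST') blast
      ultimately show ?thesis
        by blast
    qed
  qed
  then obtain x y where xy: "x \<in> I" "y \<in> J" "1 = x + y"
    by blast
  moreover have "1 - x = y"
    by (simp add: xy(3))
  ultimately show thesis
    using that[of x] by (auto simp: I_def J_def)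
qed

section \<open>Integer-valued polynomials over a Jaffard family\<close>

text \<open>For nonzero \<open>c\<close>: polynomials over \<open>A\<close> respect congruence
  modulo \<open>cA\<close>. The Horner step is x p(x) - y p(y) = x (p(x) - p(y)) + (x - y)
  p(y).\<close>

lemma poly_diff_divide_mem:
  assumes "is_subring A" "\<And>i. Polynomial.coeff p i \<in> A" "x \<in> A" "y \<in> A" "(x - y) / c \<in> A"
  shows "poly p x \<in> A \<and> (poly p x - poly p y) / c \<in> A"
  using assms(2)
proof (induction p)
  case 0
  then show ?case
    using subring_zero[OF assms(1)] by simp
next
  case (pCons a p)
  have a: "a \<in> A" and p: "\<And>i. Polynomial.coeff p i \<in> A"
    using pCons.prems[of 0] pCons.prems[of "Suc i" for i] by simp_all
  note IH = pCons.IH[OF p]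
  have py: "poly p y \<in> A"
    using p
  proof (induction p)
    case (pCons b q)
    then have "b \<in> A" "\<And>i. Polynomial.coeff q i \<in> A"
      using pCons.prems[of 0] pCons.prems[of "Suc i" for i] by simp_all
    then show ?case
      using pCons.IH assms by (simp add: subring_add subring_mult)
  qed (simp add: subring_zero[OF assms(1)])
  have eq: "(poly (pCons a p) x - poly (pCons a p) y) / c
      = x * ((poly p x - poly p y) / c) + ((x - y) / c) * poly p y"
    by (simp add: algebra_simps diff_divide_distrib add_divide_distrib)
  show ?case
    unfolding eq using IH a py assms
    by (simp add: subring_add subring_mult del: times_divide_eq_right times_divide_eq_left)
qed

text \<open>For \<open>t \<in> T\<close>, separation yields \<open>e\<close> with \<open>e * t \<in> D\<close> and \<open>e\<close> so close to 1 in \<open>T\<close> that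
  \<open>f(e * t) - f(t) \<in> T\<close>.\<close>

lemma IntPoly_subset:
  assumes T: "T \<in> \<Theta>"
  shows "IntPoly D \<subseteq> IntPoly T"
proof
  fix f assume f: "f \<in> IntPoly D"
  note ST = Theta_subring[OF T]
  show "f \<in> IntPoly T"
    unfolding IntPoly_def
  proof (intro CollectI ballI)
    fix t assume t: "t \<in> T"
    obtain b where b: "b \<in> D" "b \<noteq> 0" "b * t \<in> D"
      using qf_den[OF D] .
    obtain c where c: "c \<in> D" "c \<noteq> 0" "\<And>x. x \<in> Polynomial.coeff f ` {..Polynomial.degree f} \<Longrightarrow> c * x \<in> D"
      using common_denominator[of "Polynomial.coeff f ` {..Polynomial.degree f}"] by blast
    have cf: "Polynomial.coeff (Polynomial.smult c f) i \<in> D" for i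
      using c(3)[of "Polynomial.coeff f i"] subring_zero[OF SD]
      by (cases "i \<le> Polynomial.degree f") (auto simp: Polynomial.coeff_eq_0)
    \<comment> \<open>The factor \<open>b\<close> of the modulus absorbs the denominator of
      \<open>t\<close>, the factor \<open>c\<close> those of the coefficients of \<open>f\<close>.
      Away from \<open>T\<close> this gives \<open>e * t \<in> T'\<close>; at \<open>T\<close> it
      makes \<open>e * t - t\<close> divisible by \<open>c\<close>, which pays for replacing
      \<open>f\<close> by \<open>c\<close> times \<open>f\<close>, a polynomial over
      \<open>D\<close>.\<close>
    obtain e where e: "e \<in> D" "(1 - e) / (b * c) \<in> T"
        "\<And>T'. T' \<in> \<Theta> \<Longrightarrow> T' \<noteq> T \<Longrightarrow> e / (b * c) \<in> T'"
      using separation[OF T, of "b * c"] b c subring_mult[OF SD] by (metis mult_eq_0_iff)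
    have et: "e * t \<in> T" "b \<in> T" "c \<in> T"
      using subring_mult[OF ST] Theta_superset[OF T] e(1) b c t by auto
    have "e * t \<in> D"
    proof (rule Inter_Theta)
      fix T' assume T': "T' \<in> \<Theta>"
      show "e * t \<in> T'"
      proof (cases "T' = T")
        case False
        then have "e / (b * c) \<in> T'" "c \<in> T'" "b * t \<in> T'"
          using e(3) T' b c Theta_superset[OF T'] by blast+
        then have "e / (b * c) * (c * (b * t)) \<in> T'"
          by (simp only: subring_mult[OF Theta_subring[OF T']])
        then show ?thesis
          using b c by (simp add: field_simps)
      qed (use et in simp)
    qed
    then have 1: "poly f (e * t) \<in> T"
      using f Theta_superset[OF T] by (auto simp: IntPoly_def)
    have "(e * t - t) / c = - (b * t * ((1 - e) / (b * c)))"
      using b c by (simp add: field_simps)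
    moreover have "b * t * ((1 - e) / (b * c)) \<in> T"
      using b c e t et by (intro subring_mult ST) auto
    ultimately have "(e * t - t) / c \<in> T"
      using subring_uminus[OF ST] by simp
    then have "(poly (Polynomial.smult c f) (e * t) - poly (Polynomial.smult c f) t) / c \<in> T"
      using poly_diff_divide_mem[OF ST, of "Polynomial.smult c f" "e * t" t c] cf Theta_superset[OF T] et t
      by blast
    then have "poly f (e * t) - poly f t \<in> T"
      using c by (simp add: diff_divide_distrib)
    then show "poly f t \<in> T"
      using subring_diff[OF ST 1] by force
  qed
qed

lemma IntPoly_Inter:
  assumes "\<And>T. T \<in> \<Theta> \<Longrightarrow> f \<in> IntPoly T"
  shows "f \<in> IntPoly D"
  using assms Theta_superset Inter_Theta unfolding IntPoly_def by blast

end

section \<open>K[X] inside K(X), and K(X) as the quotient field of Int(A)\<close>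

definition emb :: "'k::field poly \<Rightarrow> 'k poly fract" where
  "emb p = Fract p 1"

lemma emb_simps [simp]:
  "emb 0 = 0" "emb 1 = 1" "emb (p + q) = emb p + emb q" "emb (p * q) = emb p * emb q"
  "emb (p - q) = emb p - emb q" "emb (- p) = - emb p"
  by (simp_all add: emb_def Zero_fract_def One_fract_def)

lemma emb_eq_iff [simp]: "emb p = emb q \<longleftrightarrow> p = q"
  by (simp add: emb_def eq_fract)

lemma emb_eq_0_iff [simp]: "emb p = 0 \<longleftrightarrow> p = 0"
  using emb_eq_iff[of p 0] by simp

lemma constK_emb: "constK a = emb [:a:]"
  by (simp add: constK_def emb_def)

lemma constK_simps [simp]: "constK 0 = 0" "constK 1 = 1"
  by (simp_all add: constK_emb flip: one_pCons)

lemma constK_add: "constK (a + b) = constK a + constK b"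
  and constK_diff: "constK (a - b) = constK a - constK b"
  and constK_mult: "constK (a * b) = constK a * constK b"
  by (simp_all add: constK_emb flip: emb_simps)

lemma constK_mult_emb: "constK a * emb p = emb (Polynomial.smult a p)"
  by (simp add: constK_emb flip: emb_simps)

lemma constK_eq_0_iff [simp]: "constK a = 0 \<longleftrightarrow> a = 0"
  by (simp add: constK_emb)

lemma IntF_emb: "IntF A = emb ` IntPoly A"
  by (simp add: IntF_def emb_def)

lemma emb_mem_IntF [simp]: "emb p \<in> IntF A \<longleftrightarrow> p \<in> IntPoly A"
  by (auto simp: IntF_emb)

lemma IntF_cases:
  assumes "x \<in> IntF A"
  obtains p where "x = emb p" "p \<in> IntPoly A"
  using assms by (auto simp: IntF_emb)

text \<open>Hence \<open>IntF UNIV\<close> is the copy of K[X] in K(X), and K[X] is treated as the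
  case A = K of Int(A).\<close>

lemma IntPoly_UNIV [simp]: "IntPoly UNIV = UNIV"
  by (simp add: IntPoly_def)

lemma IntF_subset_UNIV: "IntF A \<subseteq> IntF UNIV"
  by (auto simp: IntF_emb)

lemma IntF_UNIV: "x \<in> IntF A \<Longrightarrow> x \<in> IntF UNIV"
  by (rule subsetD[OF IntF_subset_UNIV])

lemma subring_IntF:
  assumes "is_subring A"
  shows "is_subring (IntF A)"
  unfolding is_subring_def
proof (intro conjI ballI)
  show "0 \<in> IntF A" "1 \<in> IntF A"
    using assms emb_mem_IntF[of 0 A] emb_mem_IntF[of 1 A]
    by (simp_all add: IntPoly_def subring_zero subring_one)
next
  fix x y assume "x \<in> IntF A" "y \<in> IntF A"
  then obtain p q where p: "x = emb p" "p \<in> IntPoly A" and q: "y = emb q" "q \<in> IntPoly A"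
    by (elim IntF_cases)
  have "p + q \<in> IntPoly A" "p * q \<in> IntPoly A" "- p \<in> IntPoly A"
    using p q assms by (simp_all add: IntPoly_def subring_add subring_mult subring_uminus)
  then have "emb (p + q) \<in> IntF A" "emb (p * q) \<in> IntF A" "emb (- p) \<in> IntF A"
    by (simp_all only: emb_mem_IntF)
  then show "x + y \<in> IntF A" "x * y \<in> IntF A" "- x \<in> IntF A"
    unfolding p q by (simp_all only: emb_simps)
qed

lemma constK_mem_IntF:
  assumes "is_subring A"
  shows "constK a \<in> IntF A \<longleftrightarrow> a \<in> A"
  using subring_zero[OF assms] by (auto simp: constK_emb IntPoly_def)

text \<open>The denominator is built along Horner's scheme: \<open>b\<close> serves the values of
  the tail \<open>p\<close>, and \<open>c\<close> the constant coefficient \<open>a\<close>.\<close>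

lemma poly_den:
  assumes A: "domain_with_qf A"
  shows "\<exists>b\<in>A. b \<noteq> 0 \<and> Polynomial.smult b p \<in> IntPoly A"
proof (induction p)
  case 0
  then show ?case
    using subring_one[OF qf_subring[OF A]] subring_zero[OF qf_subring[OF A]]
    by (intro bexI[of _ 1]) (auto simp: IntPoly_def)
next
  case (pCons a p)
  then obtain b where b: "b \<in> A" "b \<noteq> 0" "\<And>x. x \<in> A \<Longrightarrow> b * poly p x \<in> A"
    by (auto simp: IntPoly_def)
  obtain c where c: "c \<in> A" "c \<noteq> 0" "c * a \<in> A"
    using qf_den[OF A] .
  have "b * (c * a) + x * (c * (b * poly p x)) \<in> A" if "x \<in> A" for x
    using that b c by (simp only: subring_add subring_mult qf_subring[OF A])
  then have "Polynomial.smult (b * c) (pCons a p) \<in> IntPoly A"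
    by (simp add: IntPoly_def algebra_simps)
  then show ?case
    using b c subring_mult[OF qf_subring[OF A]] by (intro bexI[of _ "b * c"]) auto
qed

lemma IntF_den:
  assumes A: "domain_with_qf A" and "x \<in> IntF UNIV"
  obtains b where "b \<in> A" "b \<noteq> 0" "constK b * x \<in> IntF A"
proof -
  obtain p where p: "x = emb p"
    using assms(2) by (elim IntF_cases)
  obtain b where "b \<in> A" "b \<noteq> 0" "Polynomial.smult b p \<in> IntPoly A"
    using poly_den[OF A] by blast
  then show thesis
    using that by (simp add: p constK_mult_emb)
qed

lemma qf_IntF:
  assumes A: "domain_with_qf A"
  shows "domain_with_qf (IntF A)"
  unfolding domain_with_qf_def
proof (intro conjI allI)
  note S = subring_IntF[OF qf_subring[OF A]]
  show "is_subring (IntF A)" by (rule S)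
  fix x :: "'a poly fract"
  obtain p q where pq: "x = Fract p q" "q \<noteq> 0"
    by (cases x) auto
  have x: "x = emb p / emb q"
    using pq by (simp add: emb_def)
  obtain b where b: "b \<in> A" "b \<noteq> 0" "constK b * emb p \<in> IntF A"
    by (rule IntF_den[OF A, of "emb p"]) simp_all
  obtain c where c: "c \<in> A" "c \<noteq> 0" "constK c * emb q \<in> IntF A"
    by (rule IntF_den[OF A, of "emb q"]) simp_all
  have "constK c * (constK b * emb p) \<in> IntF A" "constK b * (constK c * emb q) \<in> IntF A"
    using b c by (simp_all only: subring_mult[OF S] constK_mem_IntF[OF qf_subring[OF A]])
  moreover have "constK b * (constK c * emb q) \<noteq> 0"
    using b c pq by simp
  moreover have "x = constK c * (constK b * emb p) / (constK b * (constK c * emb q))"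
    using b c pq x by simp
  ultimately show "\<exists>a\<in>IntF A. \<exists>b\<in>IntF A. b \<noteq> 0 \<and> x = a / b"
    by blast
qed

lemma qf_UNIV: "domain_with_qf (UNIV :: 'k::field set)"
proof -
  have "\<exists>a b. b \<noteq> 0 \<and> x = a / b" for x :: 'k
    by (intro exI[of _ x] exI[of _ 1]) simp
  then show ?thesis
    by (auto simp: domain_with_qf_def is_subring_def)
qed

lemma ring_ext_id:
  assumes "domain_with_qf R" "domain_with_qf R'" "R \<subseteq> R'"
  shows "ring_ext (\<lambda>x. x) R R'"
  using assms by (auto simp: ring_ext_def)

lemma ring_ext_constK:
  assumes "domain_with_qf A"
  shows "ring_ext constK A (IntF A)"
  using assms qf_IntF[OF assms] constK_mem_IntF[OF qf_subring[OF assms]]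
  by (simp add: ring_ext_def constK_add constK_mult)

section \<open>Normalized representatives\<close>

text \<open>\<open>J\<close> and its inverse \<open>J'\<close> lie in \<open>K[X]\<close>; the common constant \<open>d\<close> witnesses that both extend
  to the unit ideal of \<open>K[X]\<close>.\<close>

definition normal_pair :: "'k::field set \<Rightarrow> 'k \<Rightarrow> 'k poly fract set \<Rightarrow> 'k poly fract set \<Rightarrow> bool" where
  "normal_pair A d J J' \<longleftrightarrow> submod (IntF A) J \<and> submod (IntF A) J' \<and> ideal_prod (IntF A) J J' = IntF A
     \<and> J \<subseteq> IntF UNIV \<and> J' \<subseteq> IntF UNIV \<and> d \<noteq> 0 \<and> constK d \<in> J \<and> constK d \<in> J'"

lemma normal_pair_commute: "normal_pair A d J J' \<Longrightarrow> normal_pair A d J' J"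
  unfolding normal_pair_def by (subst ideal_prod_commute[of "IntF A" J' J]) blast

lemma normal_pairD:
  assumes "normal_pair A d J J'"
  shows "submod (IntF A) J" "ideal_prod (IntF A) J J' = IntF A"
    "J \<subseteq> IntF UNIV" "d \<noteq> 0" "constK d \<in> J"
  using assms by (simp_all add: normal_pair_def)

lemma normal_pair_invertible:
  assumes "domain_with_qf A" "normal_pair A d J J'"
  shows "invertible_ideal (IntF A) J"
  using assms(2) unfolding invertible_ideal_iff[OF qf_IntF[OF assms(1)]] normal_pair_def by blast

text \<open>Division with remainder: a nonzero polynomial of least degree in \<open>N\<close>
  divides all the others.\<close>

lemma poly_submod_principal:
  fixes N :: "'k::field poly fract set"
  assumes N: "submod (IntF UNIV) N" "N \<subseteq> IntF UNIV" and x: "x \<in> N" "x \<noteq> 0"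
  obtains g where "g \<noteq> 0" "g \<in> N" "\<And>y. y \<in> N \<Longrightarrow> y / g \<in> IntF UNIV"
proof -
  define P where "P q \<longleftrightarrow> q \<noteq> 0 \<and> emb q \<in> N" for q
  obtain p where "P p"
    using x N(2) unfolding P_def by (metis IntF_cases emb_eq_0_iff subsetD)
  then obtain g where g: "P g" "\<And>q. P q \<Longrightarrow> Polynomial.degree g \<le> Polynomial.degree q"
    using ex_has_least_nat[of P p Polynomial.degree] by blast
  have "y / emb g \<in> IntF UNIV" if y: "y \<in> N" for y
  proof -
    obtain q where q: "y = emb q"
      using y N(2) by (metis IntF_cases subsetD)
    have "emb (- (q div g)) * emb g \<in> N"
      using g(1) by (intro submod_scale[OF N(1)]) (simp_all add: P_def del: emb_simps)
    from submod_add[OF N(1) y this] have "emb (q mod g) \<in> N"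
      unfolding q by (simp add: minus_div_mult_eq_mod[symmetric] flip: emb_simps)
    then have "q mod g = 0"
      using g degree_mod_less[of g q] by (fastforce simp: P_def)
    then have "q = (q div g) * g"
      using div_mult_mod_eq[of q g] by simp
    then have "y = emb (q div g) * emb g"
      by (simp add: q flip: emb_simps)
    then have "y / emb g = emb (q div g)"
      using g(1) by (simp add: P_def)
    then show ?thesis by simp
  qed
  then show thesis
    using g(1) by (intro that[of "emb g"]) (auto simp: P_def)
qed

text \<open>If 1 is a K[X]-combination of elements of \<open>J\<close>, a common denominator of the
  coefficients turns it into an Int(A)-combination, which is then a constant in
  \<open>J\<close>.\<close>

lemma const_mem_of_one_mem:
  assumes A: "domain_with_qf A" and J: "submod (IntF A) J" and one: "1 \<in> rgen (IntF UNIV) J"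
  obtains b where "b \<in> A" "b \<noteq> 0" "constK b \<in> J"
proof -
  note S = qf_subring[OF A]
  have "\<exists>b\<in>A. b \<noteq> 0 \<and> constK b * y \<in> J" if "y \<in> rgen (IntF UNIV) J" for y
    using that
  proof (induction rule: rgen_induct)
    case zero
    then show ?case
      using submod_zero[OF J] subring_one[OF S] by (intro bexI[of _ 1]) auto
  next
    case (step r s y)
    obtain b where b: "b \<in> A" "b \<noteq> 0" "constK b * r \<in> IntF A"
      using IntF_den[OF A step(1)] .
    obtain c where c: "c \<in> A" "c \<noteq> 0" "constK c * y \<in> J"
      using step by blast
    have "(constK c * (constK b * r)) * s + constK b * (constK c * y) \<in> J"
      using b c step(2) by (simp only: submod_add[OF J] submod_scale[OF J]
          subring_mult[OF subring_IntF[OF S]] constK_mem_IntF[OF S])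
    then have "constK (b * c) * (r * s + y) \<in> J"
      by (simp add: constK_mult algebra_simps)
    then show ?case
      using b c subring_mult[OF S] by (intro bexI[of _ "b * c"]) auto
  qed
  from this[OF one] show thesis
    using that by auto
qed

text \<open>A common denominator \<open>d\<close>, here an element of K(X), moves \<open>I\<close>
  into Int(A). Dividing by the generator \<open>g\<close> of the resulting ideal of K[X] makes that
  ideal trivial, so the scaling factor is \<open>d / g\<close>.\<close>

lemma normal_pair_exists:
  assumes A: "domain_with_qf A" and I: "invertible_ideal (IntF A) I"
  obtains J J' d where "J \<in> cls (IntF A) I" "normal_pair A d J J'" "d \<in> A"
proof -
  note R = qf_IntF[OF A]
  note S = qf_subring[OF R] and U = qf_subring[OF qf_IntF[OF qf_UNIV]]
  interpret ext: ring_ext "\<lambda>x. x" "IntF A" "IntF UNIV"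
    by (intro ring_ext_id R qf_IntF qf_UNIV IntF_subset_UNIV)
  have scaled: "rgen (IntF UNIV) ((\<lambda>r. x * r) ` L) = (\<lambda>r. x * r) ` rgen (IntF UNIV) L"
    if "submod (IntF A) L" for L x
    using ext.ext_scaled[OF that, of x] by (simp add: image_image)
  have sI: "submod (IntF A) I"
    using I invertible_ideal_iff[OF R] by blast
  obtain d where d: "d \<noteq> 0" "\<And>y. y \<in> I \<Longrightarrow> d * y \<in> IntF A"
    using I unfolding invertible_ideal_def frac_ideal_def by blast
  obtain i where i: "i \<in> I" "i \<noteq> 0"
    using I submod_zero[OF sI] unfolding invertible_ideal_def frac_ideal_def by blast
  define N where "N = rgen (IntF UNIV) ((\<lambda>r. d * r) ` I)"
  have sN: "submod (IntF UNIV) N"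
    unfolding N_def by (rule submod_rgen[OF U])
  have N_sub: "N \<subseteq> IntF UNIV"
    unfolding N_def by (intro rgen_subset submod_self U image_subsetI IntF_UNIV[OF d(2)])
  have dI: "d * y \<in> N" if "y \<in> I" for y
    unfolding N_def by (rule subsetD[OF rgen_superset[OF U]], rule image_eqI[OF refl that])
  obtain g where g: "g \<noteq> 0" "g \<in> N" "\<And>y. y \<in> N \<Longrightarrow> y / g \<in> IntF UNIV"
    by (rule poly_submod_principal[OF sN N_sub dI[OF i(1)] no_zero_divisors[OF d(1) i(2)]])
       (rule that)
  define x where "x = d / g"
  have x: "x \<noteq> 0"
    using g d by (simp add: x_def)
  define J where "J = (\<lambda>r. x * r) ` I"
  have J: "J \<in> cls (IntF A) I"
    using x mem_cls[OF R I] by (auto simp: J_def)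
  have invJ: "invertible_ideal (IntF A) J"
    by (rule cls_invertible[OF R I J])
  then obtain J' where J': "submod (IntF A) J" "submod (IntF A) J'" "ideal_prod (IntF A) J J' = IntF A"
    using invertible_ideal_iff[OF R] by blast
  have J_sub: "J \<subseteq> IntF UNIV"
    using g(3)[OF dI] by (auto simp: J_def x_def)
  have J_one: "1 \<in> rgen (IntF UNIV) J"
  proof -
    have "g \<in> (\<lambda>r. d * r) ` rgen (IntF UNIV) I"
      using g(2) by (simp add: N_def scaled[OF sI])
    then obtain z where z: "g = d * z" "z \<in> rgen (IntF UNIV) I"
      by blast
    then have "1 = x * z"
      using g(1) by (simp add: x_def)
    then show ?thesis
      unfolding J_def scaled[OF sI] using z(2) by blast
  qed
  \<comment> \<open>The inverse is normalized automatically: since JJ' = Int(A), having 1 in J K[X]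
    gives J' \<subseteq> K[X], and having J \<subseteq> K[X] gives 1 in J' K[X].\<close>
  have "rgen (IntF UNIV) J \<subseteq> {z. \<forall>y\<in>J'. z * y \<in> IntF UNIV}"
    using ideal_prod_mem[OF S, of _ J _ J'] unfolding J'(3)
    by (intro rgen_subset submod_quotient submod_self U subsetI CollectI ballI IntF_UNIV)
  then have J'_sub: "J' \<subseteq> IntF UNIV"
    using J_one by auto
  have "ideal_prod (IntF A) J J' \<subseteq> rgen (IntF UNIV) J'"
    using J_sub by (intro ideal_prod_subset submod_antimono[OF submod_rgen[OF U]] IntF_subset_UNIV)
      (auto intro: rgen_mult_mem)
  then have J'_one: "1 \<in> rgen (IntF UNIV) J'"
    using J'(3) subring_one[OF S] by blast
  obtain b where b: "b \<in> A" "b \<noteq> 0" "constK b \<in> J"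
    using const_mem_of_one_mem[OF A J'(1) J_one] .
  obtain c where c: "c \<in> A" "c \<noteq> 0" "constK c \<in> J'"
    using const_mem_of_one_mem[OF A J'(2) J'_one] .
  have "constK (c * b) \<in> J" "constK (b * c) \<in> J'"
    unfolding constK_mult using b c
    by (simp_all only: submod_scale[OF J'(1)] submod_scale[OF J'(2)] constK_mem_IntF[OF qf_subring[OF A]])
  then have "normal_pair A (b * c) J J'"
    using J' J_sub J'_sub b c by (simp add: normal_pair_def mult.commute)
  then show thesis
    using that J b c subring_mult[OF qf_subring[OF A]] by blast
qed

text \<open>Both extensions contain \<open>inverse d * d = 1\<close>. As the second one contains 1,
  the first lies in their product, which is Int(T).\<close>

lemma normal_pair_extension_trivial:
  assumes A: "domain_with_qf A" and T: "domain_with_qf T" and sub: "IntF A \<subseteq> IntF T"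
    and np: "normal_pair A d J J'" and d: "inverse d \<in> T"
  shows "rgen (IntF T) J = IntF T"
proof -
  interpret ext: ring_ext "\<lambda>x. x" "IntF A" "IntF T"
    by (intro ring_ext_id qf_IntF A T sub)
  have one: "1 \<in> rgen (IntF T) L" if "constK d \<in> L" for L
  proof -
    have "constK (inverse d) * constK d \<in> rgen (IntF T) L"
      using d that by (intro rgen_mult_mem) (simp_all add: constK_mem_IntF[OF qf_subring[OF T]])
    then show ?thesis
      using np by (simp add: normal_pair_def flip: constK_mult)
  qed
  have prod: "ideal_prod (IntF T) (rgen (IntF T) J) (rgen (IntF T) J') = IntF T"
    using ext.ext_prod[of J J'] ext.ext_self np by (simp add: normal_pair_def)
  show ?thesis
  proof
    show "rgen (IntF T) J \<subseteq> IntF T"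
    proof
      fix x assume "x \<in> rgen (IntF T) J"
      then have "x * 1 \<in> ideal_prod (IntF T) (rgen (IntF T) J) (rgen (IntF T) J')"
        using np by (intro ideal_prod_mem ext.SR' one) (simp_all add: normal_pair_def)
      then show "x \<in> IntF T"
        by (simp add: prod)
    qed
    show "IntF T \<subseteq> rgen (IntF T) J"
    proof
      fix x assume "x \<in> IntF T"
      from submod_scale[OF submod_rgen[OF ext.SR'] this one] np show "x \<in> rgen (IntF T) J"
        by (simp add: normal_pair_def)
    qed
  qed
qed

text \<open>The generator equals itself times 1, so it lies in \<open>J\<close> and is a polynomial;
  its cofactor for \<open>d\<close> lies in Int(A). Thus \<open>d\<close> is factored inside K[X],
  and the degrees add up to 0.\<close>

lemma IntF_principal_const:
  assumes U: "is_subring A" and J: "J \<subseteq> IntF UNIV" "d \<noteq> 0" "constK d \<in> J"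
    and principal: "principal_ideal (IntF A) J"
  obtains c where "c \<noteq> 0" "J = (\<lambda>r. constK c * r) ` IntF A"
proof -
  obtain f where f: "f \<noteq> 0" "J = (\<lambda>r. f * r) ` IntF A"
    using principal by (auto simp: principal_ideal_def)
  have "f * 1 \<in> J"
    unfolding f(2) by (intro imageI subring_one subring_IntF U)
  then obtain p where p: "f = emb p"
    using J(1) IntF_cases by (metis mult_1_right subsetD)
  obtain g where g: "constK d = f * g" "g \<in> IntF A"
    using J(3) f(2) by blast
  then obtain q where q: "g = emb q"
    by (elim IntF_cases)
  have pq: "[:d:] = p * q"
    using g(1) by (simp add: p q constK_emb flip: emb_simps)
  then have "Polynomial.degree p + Polynomial.degree q = 0"
    using J(2) degree_mult_eq[of p q] by (metis degree_pCons_0 mult_eq_0_iff pCons_eq_0_iff)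
  then obtain c where "p = [:c:]"
    by (metis add_eq_0_iff_both_eq_0 degree_eq_zeroE)
  then have c: "f = constK c"
    by (simp add: p constK_emb)
  then show thesis
    using f that by auto
qed

section \<open>Local-global principles for integer-valued polynomials\<close>

context jaffard_family
begin

lemma qf_Theta: "T \<in> \<Theta> \<Longrightarrow> domain_with_qf T"
  by (rule qf_overring[OF Theta_subring Theta_superset])

lemma IntF_subset: "T \<in> \<Theta> \<Longrightarrow> IntF D \<subseteq> IntF T"
  unfolding IntF_emb by (rule image_mono[OF IntPoly_subset])

lemmas SRD = subring_IntF[OF SD]

lemma SRT: "T \<in> \<Theta> \<Longrightarrow> is_subring (IntF T)"
  by (rule subring_IntF[OF Theta_subring])

lemma IntF_Inter:
  assumes "\<And>T. T \<in> \<Theta> \<Longrightarrow> x \<in> IntF T"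
  shows "x \<in> IntF D"
proof -
  \<comment> \<open>Some member is needed to know that \<open>x\<close> is a polynomial at
    all.\<close>
  obtain T0 where "T0 \<in> \<Theta>"
    using Theta_nonempty by blast
  then obtain p where p: "x = emb p"
    using assms by (meson IntF_cases)
  then have "p \<in> IntPoly T" if "T \<in> \<Theta>" for T
    using assms[OF that] by simp
  then show ?thesis
    unfolding p emb_mem_IntF by (rule IntPoly_Inter)
qed

lemma constK_mem_Theta: "T \<in> \<Theta> \<Longrightarrow> constK a \<in> IntF T \<longleftrightarrow> a \<in> T"
  by (rule constK_mem_IntF[OF Theta_subring])

lemma ext_T: "T \<in> \<Theta> \<Longrightarrow> ring_ext (\<lambda>x. x) (IntF D) (IntF T)"
  by (intro ring_ext_id qf_IntF D qf_Theta IntF_subset)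

lemma ext_D_T: "T \<in> \<Theta> \<Longrightarrow> ring_ext (\<lambda>x. x) D T"
  by (intro ring_ext_id D qf_Theta Theta_superset)

lemma den_D:
  assumes "x \<in> IntF UNIV"
  obtains b where "b \<in> D" "b \<noteq> 0" "constK b * x \<in> IntF D"
  using IntF_den[OF D assms] .

text \<open>An element of one member of a family of submodules of \<open>K[X]\<close> is pushed into all the others
  by an \<open>e\<close> that is sufficiently divisible there.\<close>

lemma localize:
  assumes T: "T \<in> \<Theta>" and J: "\<And>T. T \<in> \<Theta> \<Longrightarrow> submod (IntF T) (J T)"
    and d: "d \<in> D" "d \<noteq> 0" "\<And>T. T \<in> \<Theta> \<Longrightarrow> constK d \<in> J T"
    and x: "x \<in> IntF UNIV" "x \<in> J T"
  obtains c where "c \<in> D" "c \<noteq> 0"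
    "\<forall>e\<in>D. (\<forall>T'\<in>\<Theta> - {T}. e / c \<in> T') \<longrightarrow> (\<forall>T'\<in>\<Theta>. constK e * x \<in> J T')"
proof -
  \<comment> \<open>At another member \<open>T'\<close>, \<open>e * x\<close> is regrouped as
    \<open>e / (b * d)\<close> times \<open>b * x\<close> times \<open>d\<close>: the first two
    factors lie in Int(T'), the last in \<open>J T'\<close>. Hence the modulus
    \<open>b * d\<close>.\<close>
  obtain b where b: "b \<in> D" "b \<noteq> 0" "constK b * x \<in> IntF D"
    using den_D[OF x(1)] .
  have "constK e * x \<in> J T'"
    if e: "e \<in> D" "\<forall>T'\<in>\<Theta> - {T}. e / (b * d) \<in> T'" and T': "T' \<in> \<Theta>" for e T'
  proof (cases "T' = T")
    case True
    have "e \<in> T"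
      using e(1) Theta_superset[OF T] by blast
    then show ?thesis
      unfolding True using x(2) by (intro submod_scale[OF J[OF T]]) (simp_all add: constK_mem_Theta T)
  next
    case False
    have "constK (e / (b * d)) \<in> IntF T'"
      using e(2) T' False by (simp add: constK_mem_Theta[OF T'])
    moreover have "constK b * x \<in> IntF T'"
      using b(3) IntF_subset[OF T'] by blast
    ultimately have "constK (e / (b * d)) * ((constK b * x) * constK d) \<in> J T'"
      using submod_scale[OF J[OF T']] d(3)[OF T'] by blast
    also have "constK (e / (b * d)) * ((constK b * x) * constK d) = constK (e / (b * d) * (b * d)) * x"
      unfolding constK_mult by (simp only: mult_ac)
    also have "e / (b * d) * (b * d) = e"
      using b d by simp
    finally show ?thesis .
  qed
  then have "\<forall>e\<in>D. (\<forall>T'\<in>\<Theta> - {T}. e / (b * d) \<in> T') \<longrightarrow> (\<forall>T'\<in>\<Theta>. constK e * x \<in> J T')"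
    by simp
  moreover have "b * d \<in> D" "b * d \<noteq> 0"
    using b d subring_mult[OF SD] by auto
  ultimately show thesis
    by (intro that[of "b * d"])
qed

text \<open>The constants of \<open>D\<close> that carry \<open>x\<close> into \<open>A\<close> form
  an ideal \<open>a\<close> of \<open>D\<close>. By completeness it suffices that \<open>a\<close>
  extends to the whole of every \<open>T\<close>, and there 1 = e + (1 - e) with \<open>e\<close> in
  \<open>a\<close> and \<open>1 - e\<close> a \<open>T\<close>-multiple of an element of
  \<open>a\<close>.\<close>

lemma local_global:
  assumes A: "submod (IntF D) A" and d: "d \<in> D" "d \<noteq> 0" "constK d \<in> A"
    and x: "x \<in> IntF UNIV" "\<And>T. T \<in> \<Theta> \<Longrightarrow> x \<in> rgen (IntF T) A"
  shows "x \<in> A"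
proof -
  define a where "a = {c \<in> D. constK c * x \<in> A}"
  have "1 \<in> a"
  proof (rule complete)
    show "submod D a"
    proof (rule submodI)
      show "0 \<in> a"
        using submod_zero[OF A] subring_zero[OF SD] by (simp add: a_def)
    next
      fix u v assume "u \<in> a" "v \<in> a"
      then show "u + v \<in> a"
        using submod_add[OF A] subring_add[OF SD] by (simp add: a_def constK_add distrib_right)
    next
      fix r u assume "r \<in> D" "u \<in> a"
      then show "r * u \<in> a"
        using submod_scale[OF A] subring_mult[OF SD]
        by (simp add: a_def constK_mult mult.assoc constK_mem_IntF[OF SD])
    qed
    show "a \<subseteq> D"
      by (auto simp: a_def)
    fix T assume T: "T \<in> \<Theta>"
    note ST = Theta_subring[OF T]
    \<comment> \<open>The claim covers all \<open>e\<close> divisible by \<open>c\<close> away from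
      \<open>T\<close>, because the modulus grows with each summand and \<open>e\<close> is chosen
      only at the end. Nothing is asked at \<open>T\<close>, where the coefficients are already in
      Int(T).\<close>
    have "\<exists>c\<in>D. c \<noteq> 0 \<and> (\<forall>e\<in>D. (\<forall>T'\<in>\<Theta> - {T}. e / c \<in> T') \<longrightarrow> constK e * y \<in> A)"
      if "y \<in> rgen (IntF T) A" for y
      using that
    proof (induction rule: rgen_induct)
      case zero
      show ?case
        using submod_zero[OF A] subring_one[OF SD] by (intro bexI[of _ 1]) auto
    next
      case (step r s y)
      obtain c where c: "c \<in> D" "c \<noteq> 0" "\<forall>e\<in>D. (\<forall>T'\<in>\<Theta> - {T}. e / c \<in> T') \<longrightarrow> constK e * y \<in> A"
        using step.IH by blast
      \<comment> \<open>\<open>localize\<close> is applied to the family of the rings Int(T')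
        themselves, whose common constant is 1; it clears the coefficient \<open>r\<close>.\<close>
      have k1: "constK 1 \<in> IntF T'" if "T' \<in> \<Theta>" for T'
        using subring_one[OF SRT[OF that]] by simp
      obtain b where b: "b \<in> D" "b \<noteq> 0"
        "\<forall>e\<in>D. (\<forall>T'\<in>\<Theta> - {T}. e / b \<in> T') \<longrightarrow> (\<forall>T'\<in>\<Theta>. constK e * r \<in> IntF T')"
        by (rule localize[where J = IntF, OF T submod_self[OF SRT] subring_one[OF SD] one_neq_zero k1
                IntF_UNIV[OF step(1)] step(1)], assumption, assumption)
           (rule that)
      have "constK e * (r * s + y) \<in> A" if e: "e \<in> D" "\<forall>T'\<in>\<Theta> - {T}. e / (b * c) \<in> T'" for e
      proof -
        have ebc: "e / b \<in> T'" "e / c \<in> T'" if T': "T' \<in> \<Theta>" "T' \<noteq> T" for T'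
        proof -
          have "e / (b * c) \<in> T'" "b \<in> T'" "c \<in> T'"
            using e(2) T' b(1) c(1) Theta_superset[OF T'(1)] by blast+
          then have "e / (b * c) * c \<in> T'" "e / (b * c) * b \<in> T'"
            by (simp_all only: subring_mult[OF Theta_subring[OF T'(1)]])
          then show "e / b \<in> T'" "e / c \<in> T'"
            using b(2) c(2) by simp_all
        qed
        have "constK e * r \<in> IntF D"
          using b(3) e(1) ebc(1) by (intro IntF_Inter) simp
        then have "(constK e * r) * s \<in> A"
          by (rule submod_scale[OF A _ step(2)])
        moreover have "constK e * y \<in> A"
          using c(3) e(1) ebc(2) by blast
        ultimately have "(constK e * r) * s + constK e * y \<in> A"
          by (rule submod_add[OF A])
        then show ?thesis
          by (simp only: distrib_left mult.assoc)
      qed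
      moreover have "b * c \<in> D" "b * c \<noteq> 0"
        using b c subring_mult[OF SD] by auto
      ultimately show ?case
        by blast
    qed
    from this[OF x(2)[OF T]] obtain c where c: "c \<in> D" "c \<noteq> 0"
      "\<forall>e\<in>D. (\<forall>T'\<in>\<Theta> - {T}. e / c \<in> T') \<longrightarrow> constK e * x \<in> A"
      by blast
    \<comment> \<open>\<open>b * d\<close> is a nonzero element of \<open>a\<close> available
      beforehand, as \<open>b * x\<close> lies in Int(D) and \<open>d\<close> in \<open>A\<close>.
      With modulus \<open>c * (b * d)\<close>, \<open>e\<close> is divisible by \<open>c\<close>
      away from \<open>T\<close>, and \<open>1 - e\<close> is a \<open>T\<close>-multiple of
      \<open>b * d\<close>.\<close>
    obtain b where b: "b \<in> D" "b \<noteq> 0" "constK b * x \<in> IntF D"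
      using den_D[OF x(1)] .
    have bd: "b * d \<in> D" "b * d \<noteq> 0"
      using b d subring_mult[OF SD] by auto
    have "(constK b * x) * constK d \<in> A"
      by (rule submod_scale[OF A b(3) d(3)])
    then have bda: "b * d \<in> a"
      using bd by (simp add: a_def constK_mult mult_ac)
    have "c * (b * d) \<in> D" "c * (b * d) \<noteq> 0"
      using c bd subring_mult[OF SD] by auto
    then obtain e where e: "e \<in> D" "(1 - e) / (c * (b * d)) \<in> T"
        "\<And>T'. T' \<in> \<Theta> \<Longrightarrow> T' \<noteq> T \<Longrightarrow> e / (c * (b * d)) \<in> T'"
      using separation[OF T] by blast
    have "e / c \<in> T'" if T': "T' \<in> \<Theta>" "T' \<noteq> T" for T'
    proof -
      have "e / (c * (b * d)) * (b * d) \<in> T'"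
        by (rule subring_mult[OF Theta_subring[OF T'(1)] e(3)[OF T'] subsetD[OF Theta_superset[OF T'(1)] bd(1)]])
      then show ?thesis
        using bd(2) by simp
    qed
    then have "e \<in> a"
      using c(3) e(1) by (auto simp: a_def)
    then have 1: "e \<in> rgen T a"
      by (rule subsetD[OF rgen_superset[OF ST]])
    have "(1 - e) / (c * (b * d)) * c \<in> T"
      by (rule subring_mult[OF ST e(2) subsetD[OF Theta_superset[OF T] c(1)]])
    from rgen_mult_mem[OF this bda] have "1 - e \<in> rgen T a"
      using c bd by simp
    from submod_add[OF submod_rgen[OF ST] 1 this] show "1 \<in> rgen T a"
      by simp
  qed
  then show ?thesis
    by (simp add: a_def)
qed

text \<open>Split x = e x + (1 - e) x. By \<open>localize\<close>, e x lies in every local module.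
  The rest is an Int(T)-multiple of \<open>b * x\<close> times \<open>d\<close>, which lies in every
  local module since \<open>b * x\<close> is in Int(D) and \<open>d\<close> is in each of
  them.\<close>

lemma glue:
  assumes J: "\<And>T. T \<in> \<Theta> \<Longrightarrow> submod (IntF T) (J T)" "\<And>T. T \<in> \<Theta> \<Longrightarrow> J T \<subseteq> IntF UNIV"
    and d: "d \<in> D" "d \<noteq> 0" "\<And>T. T \<in> \<Theta> \<Longrightarrow> constK d \<in> J T"
    and T: "T \<in> \<Theta>"
  shows "rgen (IntF T) (\<Inter>T\<in>\<Theta>. J T) = J T"
proof
  note SR = SRT[OF T]
  show "rgen (IntF T) (\<Inter>T\<in>\<Theta>. J T) \<subseteq> J T"
    using T by (intro rgen_subset J(1)) auto
  show "J T \<subseteq> rgen (IntF T) (\<Inter>T\<in>\<Theta>. J T)"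
  proof
    fix x assume x: "x \<in> J T"
    have xU: "x \<in> IntF UNIV"
      using J(2)[OF T] x by blast
    obtain c where c: "c \<in> D" "c \<noteq> 0"
      "\<forall>e\<in>D. (\<forall>T'\<in>\<Theta> - {T}. e / c \<in> T') \<longrightarrow> (\<forall>T'\<in>\<Theta>. constK e * x \<in> J T')"
      by (rule localize[where J = J, OF T J(1) d xU x], assumption, assumption) (rule that)
    obtain b where b: "b \<in> D" "b \<noteq> 0" "constK b * x \<in> IntF D"
      using den_D[OF xU] .
    have bd: "b * d \<in> D" "b * d \<noteq> 0"
      using b d subring_mult[OF SD] by auto
    have "c * (b * d) \<in> D" "c * (b * d) \<noteq> 0"
      using c bd subring_mult[OF SD] by auto
    then obtain e where e: "e \<in> D" "(1 - e) / (c * (b * d)) \<in> T"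
        "\<And>T'. T' \<in> \<Theta> \<Longrightarrow> T' \<noteq> T \<Longrightarrow> e / (c * (b * d)) \<in> T'"
      using separation[OF T] by blast
    have ec: "e / c \<in> T'" if T': "T' \<in> \<Theta>" "T' \<noteq> T" for T'
    proof -
      have "e / (c * (b * d)) * (b * d) \<in> T'"
        by (rule subring_mult[OF Theta_subring[OF T'(1)] e(3)[OF T'] subsetD[OF Theta_superset[OF T'(1)] bd(1)]])
      then show ?thesis
        using bd(2) by simp
    qed
    have "constK e * x \<in> (\<Inter>T\<in>\<Theta>. J T)"
      using c(3) e(1) ec by simp
    then have 1: "constK e * x \<in> rgen (IntF T) (\<Inter>T\<in>\<Theta>. J T)"
      by (rule subsetD[OF rgen_superset[OF SR]])
    have "(constK b * x) * constK d \<in> J T'" if T': "T' \<in> \<Theta>" for T'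
      using b(3) IntF_subset[OF T'] by (intro submod_scale[OF J(1)[OF T']] d(3)[OF T']) auto
    then have bxd: "(constK b * x) * constK d \<in> (\<Inter>T\<in>\<Theta>. J T)"
      by blast
    have "(1 - e) / (c * (b * d)) * c \<in> T"
      by (rule subring_mult[OF Theta_subring[OF T] e(2) subsetD[OF Theta_superset[OF T] c(1)]])
    then have "constK ((1 - e) / (c * (b * d)) * c) \<in> IntF T"
      by (simp only: constK_mem_Theta[OF T])
    from rgen_mult_mem[OF this bxd]
    have "constK ((1 - e) / (c * (b * d)) * c) * ((constK b * x) * constK d) \<in> rgen (IntF T) (\<Inter>T\<in>\<Theta>. J T)" .
    also have "constK ((1 - e) / (c * (b * d)) * c) * ((constK b * x) * constK d)
        = constK ((1 - e) / (c * (b * d)) * (c * (b * d))) * x"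
      unfolding constK_mult by (simp only: mult_ac)
    also have "(1 - e) / (c * (b * d)) * (c * (b * d)) = 1 - e"
      using c bd by simp
    finally have 2: "constK (1 - e) * x \<in> rgen (IntF T) (\<Inter>T\<in>\<Theta>. J T)" .
    from submod_add[OF submod_rgen[OF SR] 1 2] show "x \<in> rgen (IntF T) (\<Inter>T\<in>\<Theta>. J T)"
      by (simp add: constK_diff left_diff_distrib)
  qed
qed

text \<open>A single \<open>d\<close> for all members puts a nonzero constant into both
  intersections, as \<open>glue\<close> and \<open>local_global\<close> require. The product is then
  compared with Int(D) member by member.\<close>

lemma glue_normal_pair:
  assumes np: "\<And>T. T \<in> \<Theta> \<Longrightarrow> normal_pair T d (J T) (J' T)" and d: "d \<in> D"
  shows "normal_pair D d (\<Inter>T\<in>\<Theta>. J T) (\<Inter>T\<in>\<Theta>. J' T)"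
proof -
  let ?J = "\<Inter>T\<in>\<Theta>. J T" and ?J' = "\<Inter>T\<in>\<Theta>. J' T"
  obtain T0 where T0: "T0 \<in> \<Theta>"
    using Theta_nonempty by blast
  note np' = normal_pair_commute[OF np]
  have d0: "d \<noteq> 0"
    by (rule normal_pairD(4)[OF np[OF T0]])
  have sub: "submod (IntF D) (\<Inter>T\<in>\<Theta>. L T)" if "\<And>T. T \<in> \<Theta> \<Longrightarrow> submod (IntF T) (L T)" for L
  proof (rule submodI)
    show "0 \<in> (\<Inter>T\<in>\<Theta>. L T)"
      using submod_zero[OF that] by blast
  next
    fix x y assume "x \<in> (\<Inter>T\<in>\<Theta>. L T)" "y \<in> (\<Inter>T\<in>\<Theta>. L T)"
    then show "x + y \<in> (\<Inter>T\<in>\<Theta>. L T)"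
      using submod_add[OF that] by simp
  next
    fix r x assume "r \<in> IntF D" "x \<in> (\<Inter>T\<in>\<Theta>. L T)"
    then show "r * x \<in> (\<Inter>T\<in>\<Theta>. L T)"
      using submod_scale[OF that] IntF_subset by blast
  qed
  have sJ: "submod (IntF D) ?J" and sJ': "submod (IntF D) ?J'"
    by (rule sub, rule normal_pairD(1)[OF np], assumption,
        rule sub, rule normal_pairD(1)[OF np'], assumption)
  have dJ: "constK d \<in> ?J" and dJ': "constK d \<in> ?J'"
    using normal_pairD(5)[OF np] normal_pairD(5)[OF np'] by blast+
  have subU: "?J \<subseteq> IntF UNIV" "?J' \<subseteq> IntF UNIV"
    using normal_pairD(3)[OF np[OF T0]] normal_pairD(3)[OF np'[OF T0]] T0 by blast+
  have "ideal_prod (IntF D) ?J ?J' = IntF D"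
  proof
    have "a * b \<in> IntF D" if "a \<in> ?J" "b \<in> ?J'" for a b
    proof (rule IntF_Inter)
      fix T assume T: "T \<in> \<Theta>"
      have "a * b \<in> ideal_prod (IntF T) (J T) (J' T)"
        using that T by (intro ideal_prod_mem SRT) auto
      then show "a * b \<in> IntF T"
        by (simp add: normal_pairD(2)[OF np[OF T]])
    qed
    then show "ideal_prod (IntF D) ?J ?J' \<subseteq> IntF D"
      by (intro ideal_prod_subset submod_self SRD)
    have "1 \<in> ideal_prod (IntF D) ?J ?J'"
    proof (rule local_global)
      show "submod (IntF D) (ideal_prod (IntF D) ?J ?J')"
        by (rule submod_ideal_prod[OF SRD])
      \<comment> \<open>The constant in the product ideal is \<open>d * d\<close>, one factor from
        each intersection.\<close>
      show "d * d \<in> D" "d * d \<noteq> 0"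
        using d d0 subring_mult[OF SD] by auto
      show "constK (d * d) \<in> ideal_prod (IntF D) ?J ?J'"
        unfolding constK_mult by (rule ideal_prod_mem[OF SRD dJ dJ'])
      show "1 \<in> IntF (UNIV :: 'k set)"
        by (rule IntF_UNIV[OF subring_one[OF SRD]])
      fix T assume T: "T \<in> \<Theta>"
      interpret ext: ring_ext "\<lambda>x. x" "IntF D" "IntF T"
        by (rule ext_T[OF T])
      have "rgen (IntF T) (ideal_prod (IntF D) ?J ?J')
          = ideal_prod (IntF T) (rgen (IntF T) ?J) (rgen (IntF T) ?J')"
        using ext.ext_prod[of ?J ?J'] by (simp only: image_ident)
      also have "rgen (IntF T) ?J = J T"
        by (rule glue[OF normal_pairD(1)[OF np] normal_pairD(3)[OF np] d d0 normal_pairD(5)[OF np] T])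
      also have "rgen (IntF T) ?J' = J' T"
        by (rule glue[OF normal_pairD(1)[OF np'] normal_pairD(3)[OF np'] d d0 normal_pairD(5)[OF np'] T])
      also have "ideal_prod (IntF T) (J T) (J' T) = IntF T"
        by (rule normal_pairD(2)[OF np[OF T]])
      finally show "1 \<in> rgen (IntF T) (ideal_prod (IntF D) ?J ?J')"
        by (simp only: subring_one[OF SRT[OF T]])
    qed
    then show "IntF D \<subseteq> ideal_prod (IntF D) ?J ?J'"
      using submod_scale[OF submod_ideal_prod[OF SRD], of _ 1] by auto
  qed
  then show ?thesis
    using sJ sJ' subU d0 dJ dJ' by (simp only: normal_pair_def) simp
qed

text \<open>The point is that \<open>c T\<close> comes from constants of \<open>J\<close> itself.
  With \<open>v * c T\<close> in \<open>D\<close> and \<open>e\<close> taken for the modulus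
  \<open>v * d\<close>, \<open>e * c T\<close> is a multiple of \<open>d\<close> away from
  \<open>T\<close> and of \<open>c T\<close> at \<open>T\<close>, so it lies in \<open>J\<close> by
  \<open>local_global\<close>; and \<open>(1 - e) * c T\<close> is a \<open>T\<close>-multiple of
  the constant \<open>d\<close> of \<open>J\<close>.\<close>

lemma contraction:
  assumes J: "submod (IntF D) J" "J \<subseteq> IntF UNIV" and d: "d \<in> D" "d \<noteq> 0" "constK d \<in> J"
    and c: "\<And>T. T \<in> \<Theta> \<Longrightarrow> c T \<noteq> 0"
    and ext: "\<And>T. T \<in> \<Theta> \<Longrightarrow> rgen (IntF T) J = (\<lambda>r. constK (c T) * r) ` IntF T"
    and T: "T \<in> \<Theta>"
  shows "rgen T {a. constK a \<in> J} = (\<lambda>r. c T * r) ` T"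
proof
  note ST = Theta_subring[OF T]
  show "rgen T {a. constK a \<in> J} \<subseteq> (\<lambda>r. c T * r) ` T"
  proof (intro rgen_subset submod_principal ST subsetI)
    fix a assume "a \<in> {a. constK a \<in> J}"
    then have "constK a \<in> rgen (IntF T) J"
      using rgen_superset[OF SRT[OF T], of J] by blast
    then obtain r where r: "constK a = constK (c T) * r" "r \<in> IntF T"
      unfolding ext[OF T] by blast
    have "constK a = constK (c T) * constK (a / c T)"
      using c[OF T] by (simp flip: constK_mult)
    then have "r = constK (a / c T)"
      using r(1) c[OF T] by simp
    then have "a / c T \<in> T"
      using r(2) by (simp add: constK_mem_Theta[OF T])
    then show "a \<in> (\<lambda>r. c T * r) ` T"
      using c[OF T] by (intro image_eqI[where x = "a / c T"]) simp_all
  qed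
  have "c T \<in> rgen T {a. constK a \<in> J}"
  proof -
    obtain v where v: "v \<in> D" "v \<noteq> 0" "v * c T \<in> D"
      using qf_den[OF D] .
    have vd: "v * d \<in> D" "v * d \<noteq> 0"
      using v d subring_mult[OF SD] by auto
    obtain e where e: "e \<in> D" "(1 - e) / (v * d) \<in> T"
        "\<And>T'. T' \<in> \<Theta> \<Longrightarrow> T' \<noteq> T \<Longrightarrow> e / (v * d) \<in> T'"
      using separation[OF T vd] by blast
    have "constK (e * c T) \<in> J"
    proof (rule local_global[OF J(1) d])
      show "constK (e * c T) \<in> IntF UNIV"
        by (simp add: constK_emb)
      fix T' assume T': "T' \<in> \<Theta>"
      show "constK (e * c T) \<in> rgen (IntF T') J"
      proof (cases "T' = T")
        case True
        have "constK e \<in> IntF T"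
          using e(1) Theta_superset[OF T] by (auto simp: constK_mem_Theta[OF T])
        then have "constK (c T) * constK e \<in> rgen (IntF T) J"
          unfolding ext[OF T] by (rule imageI)
        then show ?thesis
          by (simp add: True constK_mult mult.commute)
      next
        case False
        have "e / (v * d) * (v * c T) \<in> T'"
          by (rule subring_mult[OF Theta_subring[OF T'] e(3)[OF T' False] subsetD[OF Theta_superset[OF T'] v(3)]])
        then have "constK (e / (v * d) * (v * c T)) * constK d \<in> rgen (IntF T') J"
          using d(3) by (intro rgen_mult_mem) (simp_all only: constK_mem_Theta[OF T'])
        moreover have "e / (v * d) * (v * c T) * d = e * c T"
          using v d by simp
        ultimately show ?thesis
          by (simp only: flip: constK_mult)
      qed
    qed
    then have 1: "e * c T \<in> rgen T {a. constK a \<in> J}"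
      by (intro subsetD[OF rgen_superset[OF ST]] CollectI)
    have "(1 - e) / (v * d) * (v * c T) \<in> T"
      by (rule subring_mult[OF ST e(2) subsetD[OF Theta_superset[OF T] v(3)]])
    then have "(1 - e) / (v * d) * (v * c T) * d \<in> rgen T {a. constK a \<in> J}"
      using d(3) by (intro rgen_mult_mem) simp_all
    moreover have "(1 - e) / (v * d) * (v * c T) * d = (1 - e) * c T"
      using v d by simp
    ultimately have "(1 - e) * c T \<in> rgen T {a. constK a \<in> J}"
      by simp
    from submod_add[OF submod_rgen[OF ST] 1 this] show ?thesis
      by (simp add: left_diff_distrib)
  qed
  then show "(\<lambda>r. c T * r) ` T \<subseteq> rgen T {a. constK a \<in> J}"
    using submod_scale[OF submod_rgen[OF ST]] by (auto simp: mult.commute[of "c T"])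
qed

lemma submod_contraction:
  assumes "submod (IntF D) J"
  shows "submod D {a. constK a \<in> J}"
  using submod_zero[OF assms] submod_add[OF assms] submod_scale[OF assms]
  by (intro submodI) (auto simp: constK_add constK_mult constK_mem_IntF[OF SD])

text \<open>Normalization forces the generators of the local extensions to be constants of \<open>K\<close>, so the
  whole ideal descends to its set of constants.\<close>

lemma locally_principal_descends:
  assumes np: "normal_pair D d J J'" and d: "d \<in> D"
    and loc: "\<And>T. T \<in> \<Theta> \<Longrightarrow> principal_ideal (IntF T) (rgen (IntF T) J)"
  obtains I where "invertible_ideal D I" "\<And>T. T \<in> \<Theta> \<Longrightarrow> principal_ideal T (rgen T I)"
    "rgen (IntF D) (constK ` I) = J"
proof -
  note np' = normal_pair_commute[OF np]
  note d0 = normal_pairD(4)[OF np]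
  have "\<exists>c. c \<noteq> 0 \<and> rgen (IntF T) J = (\<lambda>r. constK c * r) ` IntF T" if T: "T \<in> \<Theta>" for T
  proof -
    have U: "rgen (IntF T) J \<subseteq> IntF UNIV"
      using normal_pairD(3)[OF np] IntF_subset_UNIV
      by (intro rgen_subset submod_antimono[OF submod_self[OF qf_subring[OF qf_IntF[OF qf_UNIV]]]])
    have dT: "constK d \<in> rgen (IntF T) J"
      by (rule subsetD[OF rgen_superset[OF SRT[OF T]] normal_pairD(5)[OF np]])
    show ?thesis
      by (rule IntF_principal_const[OF Theta_subring[OF T] U d0 dT loc[OF T]]) (intro exI conjI)
  qed
  then obtain c where c: "\<And>T. T \<in> \<Theta> \<Longrightarrow> c T \<noteq> 0"
      "\<And>T. T \<in> \<Theta> \<Longrightarrow> rgen (IntF T) J = (\<lambda>r. constK (c T) * r) ` IntF T"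
    by metis
  \<comment> \<open>Extending JJ' = Int(D) to Int(T) determines the extension of the inverse, so
    \<open>contraction\<close> applies to \<open>J'\<close> too.\<close>
  have c': "rgen (IntF T) J' = (\<lambda>r. constK (inverse (c T)) * r) ` IntF T" if T: "T \<in> \<Theta>" for T
  proof -
    interpret ext: ring_ext "\<lambda>x. x" "IntF D" "IntF T"
      by (rule ext_T[OF T])
    have "IntF T = ideal_prod (IntF T) (rgen (IntF T) J) (rgen (IntF T) J')"
      using ext.ext_prod[of J J'] ext.ext_self
      by (simp only: image_ident normal_pairD(2)[OF np])
    also have "\<dots> = (\<lambda>r. constK (c T) * r) ` rgen (IntF T) J'"
      unfolding c(2)[OF T] by (rule ideal_prod_principal[OF ext.SR' submod_rgen[OF ext.SR']])
    finally have eq: "IntF T = (\<lambda>r. constK (c T) * r) ` rgen (IntF T) J'" .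
    have one: "constK (inverse (c T)) * (constK (c T) * r) = r" for r
    proof -
      have "constK (inverse (c T)) * constK (c T) = 1"
        using c(1)[OF T] by (simp flip: constK_mult)
      then show ?thesis
        by (simp flip: mult.assoc)
    qed
    have "(\<lambda>r. constK (inverse (c T)) * r) ` IntF T
        = (\<lambda>r. constK (inverse (c T)) * r) ` ((\<lambda>r. constK (c T) * r) ` rgen (IntF T) J')"
      by (rule arg_cong[OF eq])
    then show ?thesis
      by (simp only: image_image one image_ident)
  qed
  define I where "I = {a. constK a \<in> J}"
  define I' where "I' = {a. constK a \<in> J'}"
  have sI: "submod D I" "submod D I'"
    unfolding I_def I'_def by (intro submod_contraction normal_pairD(1)[OF np] normal_pairD(1)[OF np'])+
  have IT: "rgen T I = (\<lambda>r. c T * r) ` T" if "T \<in> \<Theta>" for T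
    unfolding I_def
    by (rule contraction[OF normal_pairD(1)[OF np] normal_pairD(3)[OF np] d d0 normal_pairD(5)[OF np] c that])
  have I'T: "rgen T I' = (\<lambda>r. inverse (c T) * r) ` T" if "T \<in> \<Theta>" for T
    unfolding I'_def
    by (rule contraction[OF normal_pairD(1)[OF np'] normal_pairD(3)[OF np'] d d0 normal_pairD(5)[OF np'] _ c' that])
       (simp add: c(1))
  \<comment> \<open>The constants of \<open>J'\<close> invert those of \<open>J\<close>: at every
    member the two extensions are generated by \<open>c T\<close> and its inverse.\<close>
  have "ideal_prod D I I' = D"
  proof
    have "a * b \<in> D" if "a \<in> I" "b \<in> I'" for a b
    proof -
      have "constK a * constK b \<in> ideal_prod (IntF D) J J'"
        using that by (intro ideal_prod_mem SRD) (simp_all add: I_def I'_def)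
      then show ?thesis
        by (simp add: normal_pairD(2)[OF np] constK_mem_IntF[OF SD] flip: constK_mult)
    qed
    then show sub: "ideal_prod D I I' \<subseteq> D"
      by (intro ideal_prod_subset submod_self SD)
    have "1 \<in> ideal_prod D I I'"
    proof (rule complete[OF submod_ideal_prod[OF SD] sub])
      fix T assume T: "T \<in> \<Theta>"
      note ST = Theta_subring[OF T]
      interpret ext: ring_ext "\<lambda>x. x" D T
        by (rule ext_D_T[OF T])
      have "c T * 1 \<in> rgen T I" "inverse (c T) * 1 \<in> rgen T I'"
        unfolding IT[OF T] I'T[OF T] by (intro imageI subring_one ST)+
      then have "(c T * 1) * (inverse (c T) * 1) \<in> ideal_prod T (rgen T I) (rgen T I')"
        by (rule ideal_prod_mem[OF ST])
      then show "1 \<in> rgen T (ideal_prod D I I')"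
        using ext.ext_prod[of I I'] c(1)[OF T] by simp
    qed
    then show "D \<subseteq> ideal_prod D I I'"
      using submod_scale[OF submod_ideal_prod[OF SD], of _ 1] by auto
  qed
  then have "invertible_ideal D I"
    using sI by (subst invertible_ideal_iff[OF D]) blast
  moreover have "principal_ideal T (rgen T I)" if "T \<in> \<Theta>" for T
    unfolding principal_ideal_def using IT[OF that] c(1)[OF that] by blast
  \<comment> \<open>Both ideals extend to the multiples of \<open>c T\<close> in every Int(T), and
    \<open>d\<close> lies in both, so \<open>local_global\<close> applies.\<close>
  moreover have "rgen (IntF D) (constK ` I) = J"
  proof
    show "rgen (IntF D) (constK ` I) \<subseteq> J"
      by (intro rgen_subset normal_pairD(1)[OF np]) (auto simp: I_def)
    show "J \<subseteq> rgen (IntF D) (constK ` I)"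
    proof
      fix x assume x: "x \<in> J"
      show "x \<in> rgen (IntF D) (constK ` I)"
      proof (rule local_global[OF submod_rgen[OF SRD] d d0])
        show "constK d \<in> rgen (IntF D) (constK ` I)"
          using normal_pairD(5)[OF np]
          by (intro subsetD[OF rgen_superset[OF SRD]] image_eqI[OF refl]) (simp add: I_def)
        show "x \<in> IntF UNIV"
          using x normal_pairD(3)[OF np] by blast
        fix T assume T: "T \<in> \<Theta>"
        interpret ext: ring_ext constK T "IntF T"
          by (rule ring_ext_constK[OF qf_Theta[OF T]])
        have "x \<in> rgen (IntF T) J"
          by (rule subsetD[OF rgen_superset[OF SRT[OF T]] x])
        also have "\<dots> = (\<lambda>r. constK (c T) * r) ` IntF T"
          by (rule c(2)[OF T])
        also have "\<dots> = rgen (IntF T) (constK ` rgen T I)"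
          unfolding IT[OF T] by (rule ext.ext_principal[symmetric])
        also have "\<dots> = rgen (IntF T) (constK ` I)"
          by (rule ext.ext_rgen)
        also have "\<dots> = rgen (IntF T) (rgen (IntF D) (constK ` I))"
          by (rule rgen_rgen[OF SRD SRT[OF T] IntF_subset[OF T], symmetric])
        finally show "x \<in> rgen (IntF T) (rgen (IntF D) (constK ` I))" .
      qed
    qed
  qed
  ultimately show thesis
    using that by blast
qed

text \<open>Comparing constants with the constant generator \<open>c\<close> gives I \<subseteq> cD.
  Conversely, the extended ideal times I' lies in Int(D), hence cI' \<subseteq> D, and multiplying
  by \<open>I\<close> puts \<open>c\<close> into \<open>I\<close>.\<close>

lemma principal_descends:
  assumes I: "invertible_ideal D I" and principal: "principal_ideal (IntF D) (rgen (IntF D) (constK ` I))"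
  shows "principal_ideal D I"
proof -
  obtain I' where I': "submod D I" "submod D I'" "ideal_prod D I I' = D"
    using I invertible_ideal_iff[OF D] by blast
  obtain i where i: "i \<in> I" "i \<noteq> 0"
    using I submod_zero[OF I'(1)] unfolding invertible_ideal_def frac_ideal_def by blast
  let ?J = "rgen (IntF D) (constK ` I)"
  have mem: "constK a \<in> ?J" if "a \<in> I" for a
    by (rule subsetD[OF rgen_superset[OF SRD] imageI[OF that]])
  have U: "?J \<subseteq> IntF UNIV"
  proof (rule rgen_subset)
    show "submod (IntF D) (IntF UNIV)"
      by (rule submod_antimono[OF submod_self[OF qf_subring[OF qf_IntF[OF qf_UNIV]]] IntF_subset_UNIV])
    show "constK ` I \<subseteq> IntF UNIV"
      by (auto simp: constK_emb)
  qed
  obtain c where c: "c \<noteq> 0" "?J = (\<lambda>r. constK c * r) ` IntF D"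
    by (rule IntF_principal_const[OF SD U i(2) mem[OF i(1)] principal]) (rule that)
  have div: "a / c \<in> D" if a: "a \<in> I" for a
  proof -
    obtain r where r: "constK a = constK c * r" "r \<in> IntF D"
      using mem[OF a] unfolding c(2) by blast
    have "constK a = constK c * constK (a / c)"
      using c(1) by (simp flip: constK_mult)
    then have "r = constK (a / c)"
      using r(1) c(1) by simp
    then show ?thesis
      using r(2) by (simp add: constK_mem_IntF[OF SD])
  qed
  have "c \<in> I"
  proof -
    have quot: "?J \<subseteq> {y. \<forall>b\<in>constK ` I'. y * b \<in> IntF D}"
    proof (intro rgen_subset submod_quotient submod_self SRD subsetI CollectI ballI)
      fix x y assume "x \<in> constK ` I" "y \<in> constK ` I'"
      then obtain a b where ab: "x = constK a" "a \<in> I" "y = constK b" "b \<in> I'"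
        by blast
      then have "a * b \<in> D"
        using ideal_prod_mem[OF SD ab(2,4)] I'(3) by simp
      then show "x * y \<in> IntF D"
        by (simp add: ab constK_mem_IntF[OF SD] flip: constK_mult)
    qed
    have "constK c * 1 \<in> ?J"
      unfolding c(2) by (intro imageI subring_one SRD)
    then have cb: "c * b \<in> D" if "b \<in> I'" for b
      using quot that by (auto simp: constK_mem_IntF[OF SD] simp flip: constK_mult)
    have "ideal_prod D I I' \<subseteq> {z. \<forall>w\<in>{c}. z * w \<in> I}"
    proof (intro ideal_prod_subset submod_quotient I'(1) CollectI ballI)
      fix a b w assume "a \<in> I" "b \<in> I'" "w \<in> {c}"
      then have "(c * b) * a \<in> I"
        using submod_scale[OF I'(1) cb] by blast
      then show "a * b * w \<in> I"
        using \<open>w \<in> {c}\<close> by (simp add: mult_ac)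
    qed
    then show ?thesis
      using I'(3) subring_one[OF SD] by auto
  qed
  have "I = (\<lambda>r. c * r) ` D"
  proof
    show "I \<subseteq> (\<lambda>r. c * r) ` D"
      using c(1) div by (intro subsetI image_eqI[where x = "x / c" for x]) auto
    show "(\<lambda>r. c * r) ` D \<subseteq> I"
      using submod_scale[OF I'(1) _ \<open>c \<in> I\<close>] by (auto simp: mult.commute[of c])
  qed
  then show ?thesis
    unfolding principal_ideal_def using c(1) by blast
qed

end

section \<open>The exact sequence\<close>

text \<open>Every member of a class represents it, so principality for one member is principality
  for all. This matches the quantifier over representatives in \<open>PicTheta\<close>.\<close>

lemma (in ring_ext) induced_eq_one_iff:
  assumes "C \<in> carrier (Pic R)"
  shows "induced R' ext C = {J. principal_ideal R' J} \<longleftrightarrow> (\<forall>I\<in>C. principal_ideal R' (ext I))"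
proof -
  obtain I where I: "invertible_ideal R I" "C = cls R I"
    using assms by (auto simp: carrier_Pic)
  have "induced R' ext C = {J. principal_ideal R' J} \<longleftrightarrow> principal_ideal R' (ext L)" if L: "L \<in> C" for L
  proof -
    have inv: "invertible_ideal R L"
      using cls_invertible[OF R I(1)] L I(2) by simp
    have "C = cls R L"
      using cls_eq[OF R I(1)] L I(2) by simp
    then show ?thesis
      using cls_eq_one_iff[OF R' ext_invertible[OF inv]] induced_cls[OF inv] by simp
  qed
  then show ?thesis
    using cls_self[OF R I(1)] I(2) by blast
qed

lemma (in ring_ext) group_hom_induced: "group_hom (Pic R) (Pic R') (induced R' ext)"
  by (intro group_hom.intro group_hom_axioms.intro group_Pic R R' induced_hom)

context jaffard_family
begin

section \<open>The two maps as group homomorphisms, and injectivity of the first\<close>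

lemma ext_constK: "ring_ext constK D (IntF D)"
  by (rule ring_ext_constK[OF D])

text \<open>Pic(D, \<Theta>) is the intersection of the kernels of the maps from Pic(D) to
  Pic(T).\<close>

lemma PicTheta_subgroup: "subgroup (carrier (PicTheta D \<Theta>)) (Pic D)"
proof -
  interpret Pic: group "Pic D"
    by (rule group_Pic[OF D])
  have kern: "kernel (Pic D) (Pic T) (induced T (rgen T))
      = {C \<in> carrier (Pic D). \<forall>I\<in>C. principal_ideal T (rgen T I)}" if T: "T \<in> \<Theta>" for T
    using ring_ext.induced_eq_one_iff[OF ext_D_T[OF T]] by (auto simp: kernel_def)
  have "subgroup (\<Inter>T\<in>\<Theta>. kernel (Pic D) (Pic T) (induced T (rgen T))) (Pic D)"
  proof (rule Pic.subgroups_Inter)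
    fix H assume "H \<in> (\<lambda>T. kernel (Pic D) (Pic T) (induced T (rgen T))) ` \<Theta>"
    then obtain T where T: "T \<in> \<Theta>" "H = kernel (Pic D) (Pic T) (induced T (rgen T))"
      by blast
    show "subgroup H (Pic D)"
      using group_hom.subgroup_kernel[OF ring_ext.group_hom_induced[OF ext_D_T[OF T(1)]]]
      by (simp add: T(2))
  qed (use Theta_nonempty in simp)
  moreover have "carrier (PicTheta D \<Theta>) = (\<Inter>T\<in>\<Theta>. kernel (Pic D) (Pic T) (induced T (rgen T)))"
    using kern Theta_nonempty by (auto simp: PicTheta_def)
  ultimately show ?thesis
    by simp
qed

lemma PicTheta_simps:
  "C \<in> carrier (PicTheta D \<Theta>) \<Longrightarrow> C \<in> carrier (Pic D)"
  "mult (PicTheta D \<Theta>) = mult (Pic D)" "one (PicTheta D \<Theta>) = one (Pic D)"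
  by (simp_all add: PicTheta_def)

lemma PicTheta_alt: "PicTheta D \<Theta> = (Pic D)\<lparr>carrier := carrier (PicTheta D \<Theta>)\<rparr>"
  by (simp add: PicTheta_def)

lemma group_hom_map1: "group_hom (PicTheta D \<Theta>) (Pic (IntF D)) (map1 D)"
proof (intro group_hom.intro group_hom_axioms.intro)
  show "group (PicTheta D \<Theta>)"
    by (subst PicTheta_alt) (rule subgroup.subgroup_is_group[OF PicTheta_subgroup group_Pic[OF D]])
  show "group (Pic (IntF D))"
    by (rule group_Pic[OF qf_IntF[OF D]])
  show "map1 D \<in> hom (PicTheta D \<Theta>) (Pic (IntF D))"
    using ring_ext.induced_hom[OF ext_constK] PicTheta_simps
    by (auto simp: hom_def map1_def)
qed

lemma map1_cls:
  "invertible_ideal D I \<Longrightarrow> map1 D (cls D I) = cls (IntF D) (rgen (IntF D) (constK ` I))"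
  unfolding map1_def by (rule ring_ext.induced_cls[OF ext_constK])

lemma map2_cls:
  assumes "invertible_ideal (IntF D) J"
  shows "map2 D \<Theta> (cls (IntF D) J) = (\<lambda>T\<in>\<Theta>. cls (IntF T) (rgen (IntF T) J))"
proof
  fix T
  show "map2 D \<Theta> (cls (IntF D) J) T = (\<lambda>T\<in>\<Theta>. cls (IntF T) (rgen (IntF T) J)) T"
    using ring_ext.induced_cls[OF ext_T assms, of T] by (simp add: map2_def)
qed

lemma ext_T_invertible:
  assumes "T \<in> \<Theta>" "invertible_ideal (IntF D) J"
  shows "invertible_ideal (IntF T) (rgen (IntF T) J)"
  using ring_ext.ext_invertible[OF ext_T[OF assms(1)] assms(2)] by simp

lemma group_Pic_Theta: "T \<in> \<Theta> \<Longrightarrow> group (Pic (IntF T))"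
  by (rule group_Pic[OF qf_IntF[OF qf_Theta]])

lemma inj_map1: "inj_on (map1 D) (carrier (PicTheta D \<Theta>))"
  unfolding group_hom.inj_on_one_iff[OF group_hom_map1]
proof (intro allI impI)
  fix C assume C: "C \<in> carrier (PicTheta D \<Theta>)" "map1 D C = one (Pic (IntF D))"
  then obtain I where I: "invertible_ideal D I" "C = cls D I"
    using PicTheta_simps(1) by (auto simp: carrier_Pic)
  have "principal_ideal (IntF D) (rgen (IntF D) (constK ` I))"
    using C(2) cls_eq_one_iff[OF qf_IntF[OF D] ring_ext.ext_invertible[OF ext_constK I(1)]]
    by (simp add: I(2) map1_cls[OF I(1)])
  then have "principal_ideal D I"
    by (rule principal_descends[OF I(1)])
  then show "C = one (PicTheta D \<Theta>)"
    using cls_eq_one_iff[OF D I(1)] by (simp add: I(2) PicTheta_simps)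
qed

lemma group_hom_map2:
  "group_hom (Pic (IntF D)) (sum_group \<Theta> (\<lambda>T. Pic (IntF T))) (map2 D \<Theta>)"
proof (intro group_hom.intro group_hom_axioms.intro)
  note R = qf_IntF[OF D]
  show "group (Pic (IntF D))"
    by (rule group_Pic[OF R])
  show "group (sum_group \<Theta> (\<lambda>T. Pic (IntF T)))"
    by (rule sum_group) (rule group_Pic_Theta)
  show "map2 D \<Theta> \<in> hom (Pic (IntF D)) (sum_group \<Theta> (\<lambda>T. Pic (IntF T)))"
  proof (rule homI)
    fix C assume "C \<in> carrier (Pic (IntF D))"
    then obtain I where I: "invertible_ideal (IntF D) I" "C = cls (IntF D) I"
      by (auto simp: carrier_Pic)
    obtain J J' d where J: "J \<in> cls (IntF D) I" and np: "normal_pair D d J J'" and d: "d \<in> D"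
      by (rule normal_pair_exists[OF D I(1)]) (rule that)
    have inv: "invertible_ideal (IntF D) J"
      by (rule normal_pair_invertible[OF D np])
    have C: "C = cls (IntF D) J"
      using cls_eq[OF R I(1) J] I(2) by simp
    \<comment> \<open>This bounds the support: a nontrivial component can occur only where
      \<open>d\<close> is a nonunit, hence at finitely many members.\<close>
    have "cls (IntF T) (rgen (IntF T) J) = one (Pic (IntF T))" if T: "T \<in> \<Theta>" "inverse d \<in> T" for T
    proof -
      have "rgen (IntF T) J = IntF T"
        by (rule normal_pair_extension_trivial[OF D qf_Theta[OF T(1)] IntF_subset[OF T(1)] np T(2)])
      then show ?thesis
        using cls_eq_one_iff[OF qf_IntF[OF qf_Theta[OF T(1)]] ext_T_invertible[OF T(1) inv]]
          principal_ideal_self[OF SRT[OF T(1)]] by simp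
    qed
    then have "{T \<in> \<Theta>. map2 D \<Theta> C T \<noteq> one (Pic (IntF T))} \<subseteq> {T \<in> \<Theta>. inverse d \<notin> T}"
      by (auto simp: C map2_cls[OF inv])
    then have "finite {T \<in> \<Theta>. map2 D \<Theta> C T \<noteq> one (Pic (IntF T))}"
      by (rule finite_subset) (rule Theta_locally_finite[OF d normal_pairD(4)[OF np]])
    moreover have "map2 D \<Theta> C \<in> (\<Pi>\<^sub>E T\<in>\<Theta>. carrier (Pic (IntF T)))"
      using ext_T_invertible[OF _ inv] by (auto simp: C map2_cls[OF inv] carrier_Pic)
    ultimately show "map2 D \<Theta> C \<in> carrier (sum_group \<Theta> (\<lambda>T. Pic (IntF T)))"
      by (simp add: carrier_sum_group group_Pic_Theta)
  next
    fix C E assume CE: "C \<in> carrier (Pic (IntF D))" "E \<in> carrier (Pic (IntF D))"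
    have "induced (IntF T) (\<lambda>J. rgen (IntF T) J) (C \<otimes>\<^bsub>Pic (IntF D)\<^esub> E)
        = induced (IntF T) (\<lambda>J. rgen (IntF T) J) C \<otimes>\<^bsub>Pic (IntF T)\<^esub> induced (IntF T) (\<lambda>J. rgen (IntF T) J) E"
      if T: "T \<in> \<Theta>" for T
      using hom_mult[OF ring_ext.induced_hom[OF ext_T[OF T]] CE] by simp
    then show "map2 D \<Theta> (C \<otimes>\<^bsub>Pic (IntF D)\<^esub> E)
        = map2 D \<Theta> C \<otimes>\<^bsub>sum_group \<Theta> (\<lambda>T. Pic (IntF T))\<^esub> map2 D \<Theta> E"
      by (auto simp: map2_def intro!: restrict_ext)
  qed
qed

section \<open>Exactness in the middle\<close>

lemma kernel_map2_iff:
  assumes J: "invertible_ideal (IntF D) J"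
  shows "cls (IntF D) J \<in> kernel (Pic (IntF D)) (sum_group \<Theta> (\<lambda>T. Pic (IntF T))) (map2 D \<Theta>)
    \<longleftrightarrow> (\<forall>T\<in>\<Theta>. principal_ideal (IntF T) (rgen (IntF T) J))"
proof -
  have "cls (IntF D) J \<in> carrier (Pic (IntF D))"
    using J by (auto simp: carrier_Pic)
  then have "cls (IntF D) J \<in> kernel (Pic (IntF D)) (sum_group \<Theta> (\<lambda>T. Pic (IntF T))) (map2 D \<Theta>)
    \<longleftrightarrow> (\<lambda>T\<in>\<Theta>. cls (IntF T) (rgen (IntF T) J)) = (\<lambda>T\<in>\<Theta>. one (Pic (IntF T)))"
    by (simp add: kernel_def map2_cls[OF J])
  also have "\<dots> \<longleftrightarrow> (\<forall>T\<in>\<Theta>. cls (IntF T) (rgen (IntF T) J) = one (Pic (IntF T)))"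
    unfolding fun_eq_iff restrict_def by (simp only: Ball_def split: if_split) blast
  also have "\<dots> \<longleftrightarrow> (\<forall>T\<in>\<Theta>. principal_ideal (IntF T) (rgen (IntF T) J))"
    using cls_eq_one_iff[OF qf_IntF[OF qf_Theta] ext_T_invertible[OF _ J]] by simp
  finally show ?thesis .
qed

lemma image_map1:
  "map1 D ` carrier (PicTheta D \<Theta>)
    = kernel (Pic (IntF D)) (sum_group \<Theta> (\<lambda>T. Pic (IntF T))) (map2 D \<Theta>)"
proof (intro subset_antisym subsetI)
  fix E assume "E \<in> map1 D ` carrier (PicTheta D \<Theta>)"
  then obtain C where C: "C \<in> carrier (PicTheta D \<Theta>)" "E = map1 D C"
    by blast
  then obtain I where I: "invertible_ideal D I" "C = cls D I"
    using PicTheta_simps(1) by (auto simp: carrier_Pic)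
  have inv: "invertible_ideal (IntF D) (rgen (IntF D) (constK ` I))"
    by (rule ring_ext.ext_invertible[OF ext_constK I(1)])
  \<comment> \<open>Extending \<open>I\<close> to Int(T) through Int(D) or through \<open>T\<close>
    gives the same ideal, and IT is principal.\<close>
  have "principal_ideal (IntF T) (rgen (IntF T) (rgen (IntF D) (constK ` I)))" if T: "T \<in> \<Theta>" for T
  proof -
    interpret ext: ring_ext constK T "IntF T"
      by (rule ring_ext_constK[OF qf_Theta[OF T]])
    have "I \<in> C"
      using cls_self[OF D I(1)] I(2) by simp
    then have "principal_ideal T (rgen T I)"
      using C(1) T by (simp add: PicTheta_def)
    then have "principal_ideal (IntF T) (rgen (IntF T) (constK ` rgen T I))"
      by (rule ext.ext_principal_ideal)
    then show ?thesis
      by (simp only: ext.ext_rgen rgen_rgen[OF SRD SRT[OF T] IntF_subset[OF T]])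
  qed
  then show "E \<in> kernel (Pic (IntF D)) (sum_group \<Theta> (\<lambda>T. Pic (IntF T))) (map2 D \<Theta>)"
    unfolding C(2) I(2) map1_cls[OF I(1)] kernel_map2_iff[OF inv] by blast
next
  fix E assume E: "E \<in> kernel (Pic (IntF D)) (sum_group \<Theta> (\<lambda>T. Pic (IntF T))) (map2 D \<Theta>)"
  then have "E \<in> carrier (Pic (IntF D))"
    by (simp add: kernel_def)
  then obtain L where L: "invertible_ideal (IntF D) L" "E = cls (IntF D) L"
    by (auto simp: carrier_Pic)
  obtain J J' d where J: "J \<in> cls (IntF D) L" and np: "normal_pair D d J J'" and d: "d \<in> D"
    by (rule normal_pair_exists[OF D L(1)]) (rule that)
  have EJ: "E = cls (IntF D) J"
    using cls_eq[OF qf_IntF[OF D] L(1) J] L(2) by simp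
  have "\<forall>T\<in>\<Theta>. principal_ideal (IntF T) (rgen (IntF T) J)"
    using E unfolding EJ kernel_map2_iff[OF normal_pair_invertible[OF D np]] .
  then have loc: "principal_ideal (IntF T) (rgen (IntF T) J)" if "T \<in> \<Theta>" for T
    using that by blast
  obtain I where I: "invertible_ideal D I" "\<forall>T\<in>\<Theta>. principal_ideal T (rgen T I)"
      "rgen (IntF D) (constK ` I) = J"
    by (rule locally_principal_descends[OF np d loc]) (auto intro: that)
  have "\<forall>L\<in>cls D I. principal_ideal T (rgen T L)" if T: "T \<in> \<Theta>" for T
  proof -
    interpret ext: ring_ext "\<lambda>x. x" D T
      by (rule ext_D_T[OF T])
    have "cls D I \<in> carrier (Pic D)"
      using I(1) by (auto simp: carrier_Pic)
    moreover have "induced T (rgen T) (cls D I) = {J. principal_ideal T J}"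
      using ext.induced_cls[OF I(1)] ext.ext_invertible[OF I(1)] cls_eq_one_iff[OF qf_Theta[OF T]] I(2) T
      by simp
    ultimately show ?thesis
      using ext.induced_eq_one_iff[of "cls D I"] by simp
  qed
  then have "cls D I \<in> carrier (PicTheta D \<Theta>)"
    using I(1) by (auto simp: PicTheta_def carrier_Pic)
  moreover have "E = map1 D (cls D I)"
    by (simp add: map1_cls[OF I(1)] I(3) EJ)
  ultimately show "E \<in> map1 D ` carrier (PicTheta D \<Theta>)"
    by blast
qed

section \<open>Surjectivity of the second map\<close>

lemma normal_pair_trivial:
  assumes "domain_with_qf A"
  shows "normal_pair A 1 (IntF A) (IntF A)"
  using subring_IntF[OF qf_subring[OF assms]] IntF_subset_UNIV[of A]
  by (simp add: normal_pair_def submod_self subring_one ideal_prod_one)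

text \<open>Lets the constants of different local pairs be replaced by a common multiple.\<close>

lemma normal_pair_scale:
  assumes "is_subring A" "normal_pair A d J J'" "c \<in> A" "c \<noteq> 0"
  shows "normal_pair A (c * d) J J'"
proof -
  have "constK (c * d) \<in> L" if "submod (IntF A) L" "constK d \<in> L" for L
    unfolding constK_mult using that assms(3)
    by (intro submod_scale[of "IntF A"]) (simp_all add: constK_mem_IntF[OF assms(1)])
  then show ?thesis
    using assms(2,4) by (simp add: normal_pair_def)
qed

lemma surj_map2:
  "map2 D \<Theta> ` carrier (Pic (IntF D)) = carrier (sum_group \<Theta> (\<lambda>T. Pic (IntF T)))"
proof (intro subset_antisym subsetI)
  fix x assume "x \<in> map2 D \<Theta> ` carrier (Pic (IntF D))"
  then show "x \<in> carrier (sum_group \<Theta> (\<lambda>T. Pic (IntF T)))"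
    using group_hom.hom_closed[OF group_hom_map2] by blast
next
  fix x assume "x \<in> carrier (sum_group \<Theta> (\<lambda>T. Pic (IntF T)))"
  then have x: "x \<in> (\<Pi>\<^sub>E T\<in>\<Theta>. carrier (Pic (IntF T)))" "finite {T \<in> \<Theta>. x T \<noteq> one (Pic (IntF T))}"
    by (simp_all add: carrier_sum_group group_Pic_Theta)
  \<comment> \<open>Trivial components are represented by Int(T) with constant 1, so that the
    product of the constants over the finite support is a multiple of the constant at every
    member.\<close>
  have "\<exists>J J' d. normal_pair T d J J' \<and> cls (IntF T) J = x T \<and> d \<in> D
      \<and> (x T = one (Pic (IntF T)) \<longrightarrow> d = 1)" if T: "T \<in> \<Theta>" for T
  proof (cases "x T = one (Pic (IntF T))")
    case True
    have "cls (IntF T) (IntF T) = x T"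
      using cls_eq_one_iff[OF qf_IntF[OF qf_Theta[OF T]]
          normal_pair_invertible[OF qf_Theta[OF T] normal_pair_trivial[OF qf_Theta[OF T]]]]
        principal_ideal_self[OF SRT[OF T]] True by simp
    then show ?thesis
      using normal_pair_trivial[OF qf_Theta[OF T]] subring_one[OF SD] by blast
  next
    case False
    have "x T \<in> carrier (Pic (IntF T))"
      using x(1) T by blast
    then obtain L where L: "invertible_ideal (IntF T) L" "x T = cls (IntF T) L"
      by (auto simp: carrier_Pic)
    obtain J J' d where J: "J \<in> cls (IntF T) L" and np: "normal_pair T d J J'" and d: "d \<in> T"
      by (rule normal_pair_exists[OF qf_Theta[OF T] L(1)]) (rule that)
    \<comment> \<open>Normalization over \<open>T\<close> yields a constant in \<open>T\<close>;
      gluing needs it in \<open>D\<close>.\<close>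
    obtain b where b: "b \<in> D" "b \<noteq> 0" "b * d \<in> D"
      using qf_den[OF D] .
    have "normal_pair T (b * d) J J'"
      using b(1) Theta_superset[OF T] by (intro normal_pair_scale[OF Theta_subring[OF T] np _ b(2)]) blast
    moreover have "cls (IntF T) J = x T"
      using cls_eq[OF qf_IntF[OF qf_Theta[OF T]] L(1) J] L(2) by simp
    ultimately show ?thesis
      using False b(3) by blast
  qed
  then obtain J J' d where JT: "\<And>T. T \<in> \<Theta> \<Longrightarrow> normal_pair T (d T) (J T) (J' T)"
      "\<And>T. T \<in> \<Theta> \<Longrightarrow> cls (IntF T) (J T) = x T" "\<And>T. T \<in> \<Theta> \<Longrightarrow> d T \<in> D"
      "\<And>T. T \<in> \<Theta> \<Longrightarrow> x T = one (Pic (IntF T)) \<Longrightarrow> d T = 1"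
    by metis
  define \<F> where "\<F> = {T \<in> \<Theta>. x T \<noteq> one (Pic (IntF T))}"
  have fin: "finite \<F>"
    unfolding \<F>_def by (rule x(2))
  have prod_D: "prod d \<G> \<in> D \<and> prod d \<G> \<noteq> 0" if "\<G> \<subseteq> \<F>" for \<G>
  proof -
    have "finite \<G>"
      using that fin by (rule finite_subset)
    then show ?thesis
      using that
    proof induction
      case empty
      then show ?case
        using subring_one[OF SD] by simp
    next
      case (insert T \<G>)
      then have "T \<in> \<Theta>"
        by (simp add: \<F>_def)
      then show ?case
        using insert JT(3) normal_pairD(4)[OF JT(1)] subring_mult[OF SD] by simp
    qed
  qed
  have np: "normal_pair T (prod d \<F>) (J T) (J' T)" if T: "T \<in> \<Theta>" for T
  proof -
    \<comment> \<open>Off the support \<open>d T = 1\<close>, and removing \<open>T\<close> from the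
      support changes nothing.\<close>
    have "prod d \<F> = prod d (\<F> - {T}) * d T"
    proof (cases "T \<in> \<F>")
      case True
      then show ?thesis
        using prod.remove[OF fin True, of d] by (simp add: mult.commute)
    next
      case False
      then show ?thesis
        using JT(4)[OF T] T by (simp add: \<F>_def)
    qed
    moreover have "prod d (\<F> - {T}) \<in> T" "prod d (\<F> - {T}) \<noteq> 0"
      using prod_D[of "\<F> - {T}"] Theta_superset[OF T] by auto
    ultimately show ?thesis
      using normal_pair_scale[OF Theta_subring[OF T] JT(1)[OF T]] by simp
  qed
  have dD: "prod d \<F> \<in> D"
    using prod_D[of \<F>] by simp
  define J0 where "J0 = (\<Inter>T\<in>\<Theta>. J T)"
  have inv: "invertible_ideal (IntF D) J0"
    unfolding J0_def by (rule normal_pair_invertible[OF D glue_normal_pair[OF np dD]])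
  have "rgen (IntF T) J0 = J T" if T: "T \<in> \<Theta>" for T
    unfolding J0_def
    by (rule glue[OF normal_pairD(1)[OF np] normal_pairD(3)[OF np] dD normal_pairD(4)[OF np[OF T]]
          normal_pairD(5)[OF np] T])
  then have "map2 D \<Theta> (cls (IntF D) J0) = (\<lambda>T\<in>\<Theta>. x T)"
    unfolding map2_cls[OF inv] by (intro restrict_ext) (simp add: JT(2))
  also have "\<dots> = x"
    using x(1) by (intro extensional_restrict) (simp add: PiE_def)
  finally have "x = map2 D \<Theta> (cls (IntF D) J0)" ..
  moreover have "cls (IntF D) J0 \<in> carrier (Pic (IntF D))"
    using inv by (auto simp: carrier_Pic)
  ultimately show "x \<in> map2 D \<Theta> ` carrier (Pic (IntF D))"
    by blast
qed

end

theorem theorem4p4: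
  fixes D :: "'k::field set" and \<Theta> :: "'k set set"
  assumes "domain_with_qf D" and "jaffard D \<Theta>"
  shows "group_hom (PicTheta D \<Theta>) (Pic (IntF D)) (map1 D)
       \<and> inj_on (map1 D) (carrier (PicTheta D \<Theta>))
       \<and> group_hom (Pic (IntF D)) (sum_group \<Theta> (\<lambda>T. Pic (IntF T))) (map2 D \<Theta>)
       \<and> map1 D ` carrier (PicTheta D \<Theta>)
           = kernel (Pic (IntF D)) (sum_group \<Theta> (\<lambda>T. Pic (IntF T))) (map2 D \<Theta>)
       \<and> map2 D \<Theta> ` carrier (Pic (IntF D)) = carrier (sum_group \<Theta> (\<lambda>T. Pic (IntF T)))"
proof -
  interpret jaffard_family D \<Theta>
    by (rule jaffard_family.intro[OF assms])
  show ?thesis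
    by (intro conjI group_hom_map1 inj_map1 group_hom_map2 image_map1 surj_map2)
qed

end
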